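(* Let $f(r)=r$ and let $q_0=(x_0,y_0,z_0)\in\mathbb R^3\setminus\Sigma$, with $r_0=\sqrt{x_0^2+y_0^2}$. For every unit-speed geodesic $\gamma$ from $q_0$ with initial covector $\lambda_0=(u_0,v_0,w_0)\in E_1$, $$t_{\mathrm{cut}}(\gamma)=\frac{\pi}{|w_0|}\qquad(\text{equal to }+\infty\text{ if }w_0=0).$$ Moreover, $$\mathrm{Cut}(q_0)=\Big\{(-x_0,-y_0,z):\ |z-z_0|\ge\frac{\pi r_0^2}{2}\Big\}.$$
   Context: Consider $\mathbb R^3$ with points $q=(x,y,z)$, $r=\sqrt{x^2+y^2}$, $\Sigma=\{r=0\}$, and the vector fields $X=\partial_x$, $Y=\partial_y$, $Z=r\,\partial_z$ (the case $f(r)=r$). Admissible curves, length and $d_{CC}$: - An absolutely continuous curve is admissible if its derivative is a.e. an $L^2$ combination of $X,Y,Z$. - Its length is $\ell(\gamma)=\int\sqrt{\dot x^2+\dot y^2+\dot z^2/r^2}\,dt$. - $d_{CC}$ is the induced infimum-of-length distance. - A length minimizer is an admissible curve not longer than any admissible curve with the same endpoints. Normal trajectories (geodesics) are projections of solutions of $$\dot x=u,\quad \dot y=v,\quad \dot z=r^2w,\quad \dot u=-w^2x,\quad \dot v=-w^2y,\quad \dot w=0,$$ with initial covector $\lambda_0=(u_0,v_0,w_0)$. The unit energy shell is $E_1=\{\lambda_0:u_0^2+v_0^2+r_0^2w_0^2=1\}$. Cut time and cut locus: - $t_{\mathrm{cut}}(\gamma)=\sup\{t>0:\gamma|_{[0,t]}\text{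 is a length minimizer}\}$. - $\mathrm{Cut}(q_0)$ is the set of points $\gamma(t_{\mathrm{cut}}(\gamma))$ over all unit-speed geodesics from $q_0$ with finite cut time. *)

theory Defs
  imports "HOL-Analysis.Analysis" "HOL-Library.Extended_Real"
begin

type_synonym pt = "real \<times> real \<times> real"

definition px :: "pt \<Rightarrow> real" where "px q = fst q"
definition py :: "pt \<Rightarrow> real" where "py q = fst (snd q)"
definition pz :: "pt \<Rightarrow> real" where "pz q = snd (snd q)"

definition rad :: "pt \<Rightarrow> real" where "rad q = sqrt ((px q)^2 + (py q)^2)"

definition sq_integrable :: "(real \<Rightarrow> real) \<Rightarrow> real set \<Rightarrow> bool" where
  "sq_integrable a S \<longleftrightarrow> a measurable_on S \<and> (\<lambda>t. (a t)^2) integrable_on S"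

text \<open>Admissible curve on [0,T]: absolutely continuous with derivative a.e. equal to
  a X + b Y + c Z with a,b,c in L^2, i.e. gamma is the indefinite integral of such a field.\<close>
definition admissible :: "real \<Rightarrow> (real \<Rightarrow> pt) \<Rightarrow> bool" where
  "admissible T \<gamma> \<longleftrightarrow> 0 \<le> T \<and>
     (\<exists>a b c. sq_integrable a {0..T} \<and> sq_integrable b {0..T} \<and> sq_integrable c {0..T} \<and>
        (\<forall>t\<in>{0..T}.
           px (\<gamma> t) = px (\<gamma> 0) + integral {0..t} a \<and>
           py (\<gamma> t) = py (\<gamma> 0) + integral {0..t} b \<and>
           pz (\<gamma> t) = pz (\<gamma> 0) + integral {0..t} (\<lambda>s. c s * rad (\<gamma> s))))"

text \<open>Length: integral of sqrt(xdot^2 + ydot^2 + zdot^2/r^2) (with zdot/0 = 0, as zdot = 0 a.e. on r = 0).\<close>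
definition cc_length :: "real \<Rightarrow> (real \<Rightarrow> pt) \<Rightarrow> real" where
  "cc_length T \<gamma> = integral {0..T} (\<lambda>t.
     (let v = vector_derivative \<gamma> (at t within {0..T})
      in sqrt ((px v)^2 + (py v)^2 + (pz v)^2 / (rad (\<gamma> t))^2)))"

definition length_minimizer :: "real \<Rightarrow> (real \<Rightarrow> pt) \<Rightarrow> bool" where
  "length_minimizer T \<gamma> \<longleftrightarrow> admissible T \<gamma> \<and>
     (\<forall>T' \<eta>. admissible T' \<eta> \<and> \<eta> 0 = \<gamma> 0 \<and> \<eta> T' = \<gamma> T \<longrightarrow> cc_length T \<gamma> \<le> cc_length T' \<eta>)"

definition E1 :: "pt \<Rightarrow> pt set" where
  "E1 q0 = {l. (px l)^2 + (py l)^2 + (rad q0)^2 * (pz l)^2 = 1}"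

text \<open>Normal trajectory from q0 with initial covector l = (u0,v0,w0): projection of the
  solution of the Hamiltonian system.\<close>
definition normal_traj :: "pt \<Rightarrow> pt \<Rightarrow> (real \<Rightarrow> pt) \<Rightarrow> bool" where
  "normal_traj q0 l \<gamma> \<longleftrightarrow> \<gamma> 0 = q0 \<and>
     (\<exists>u v w. u 0 = px l \<and> v 0 = py l \<and> w 0 = pz l \<and>
        (\<forall>t. ((\<lambda>s. px (\<gamma> s)) has_real_derivative u t) (at t) \<and>
             ((\<lambda>s. py (\<gamma> s)) has_real_derivative v t) (at t) \<and>
             ((\<lambda>s. pz (\<gamma> s)) has_real_derivative (rad (\<gamma> t))^2 * w t) (at t) \<and>
             (u has_real_derivative (- ((w t)^2 * px (\<gamma> t)))) (at t) \<and>
             (v has_real_derivative (- ((w t)^2 * py (\<gamma> t)))) (at t) \<and>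
             (w has_real_derivative 0) (at t)))"

definition t_cut :: "(real \<Rightarrow> pt) \<Rightarrow> ereal" where
  "t_cut \<gamma> = Sup {ereal t | t. t > 0 \<and> length_minimizer t \<gamma>}"

definition Cut :: "pt \<Rightarrow> pt set" where
  "Cut q0 = {\<gamma> (real_of_ereal (t_cut \<gamma>)) | \<gamma> l. l \<in> E1 q0 \<and> normal_traj q0 l \<gamma> \<and> t_cut \<gamma> < \<infinity>}"

end

theory Submission
  imports Defs
begin

text \<open>A geodesic with vertical momentum \<open>w\<close> projects to a harmonic oscillator of frequency \<open>|w|\<close> in
  the plane. Up to time \<open>\<pi> / |w|\<close> it is calibrated: for the oscillator Lagrangian there is a quadratic
  solution of the Hamilton--Jacobi equation, and evaluating it along an arbitrary competitor, with
  the arc length of the competitor as time, gives a function with nonpositive derivative almost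
  everywhere. Past \<open>\<pi> / |w|\<close> the second variation is negative in a direction that leaves
  \<open>\<integral> r\<^sup>2\<close> unchanged to first order. At time \<open>\<pi> / |w|\<close> every geodesic reaches the antipode of
  the planar starting point, at a height that depends on \<open>w\<close> only, and \<open>r\<^sub>0\<^sup>2 w\<^sup>2 \<le> 1\<close> is the only
  constraint on \<open>w\<close>.\<close>

section \<open>Absolutely continuous functions\<close>

text \<open>The obstacle is the low regularity of the competitors: they are only absolutely
  continuous, may pause and may cross the axis. Hence they are not reparametrised; their arc length
  \<open>\<sigma> t\<close> is merely inserted as the time argument of the calibration. A
  nonpositive derivative almost everywhere does not by itself give monotonicity (Cantor function),
  so absolute continuity has to be carried along with every function built from the competitor.
  Length and the quadratic Hamiltonian are linked by \<open>sqrt s \<le> (s + 1) / 2\<close>, an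
  equality at unit energy. The same inequality allows the second variation to be computed for the
  energy instead of the length. The cut time is a supremum, so the cases \<open>|w| T < pi\<close>
  and \<open>|w| T > pi\<close> decide it. Minimality at the critical time, where the Riccati
  solution has poles at both ends of \<open>[0, T]\<close>, is never examined.\<close>

lemma indefinite_integral_has_derivative_ae:
  fixes f :: "real \<Rightarrow> real"
  assumes f: "f integrable_on {a..b}"
  obtains N where "negligible N"
    "\<And>t. \<lbrakk>a < t; t < b; t \<notin> N\<rbrakk> \<Longrightarrow> ((\<lambda>s. integral {a..s} f) has_real_derivative f t) (at t)"
proof -
  define g where "g = (\<lambda>x. if x \<in> {a..b} then f x else 0)"
  have gU: "g integrable_on UNIV"
    unfolding g_def using f by (simp add: integrable_restrict_UNIV del: atLeastAtMost_iff)
  have g: "g integrable_on cbox c d" for c d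
    by (rule integrable_on_subcbox[OF gU]) auto
  \<comment> \<open>\<open>integrable_ccontinuous_explicit\<close> concerns averages over
    \<open>[x, x + h]\<close>. The reflected function supplies those over \<open>[x - h, x]\<close>,
    with a reflected exceptional set.\<close>
  have g': "(\<lambda>x. g (- x)) integrable_on cbox c d" for c d
    using g[of "-d" "-c"] Henstock_Kurzweil_Integration.integrable_reflect_real[where f=g and a="-d" and b="-c"] by simp
  obtain N1 where N1: "negligible N1"
    "\<And>x e. \<lbrakk>x \<notin> N1; 0 < e\<rbrakk> \<Longrightarrow> \<exists>d>0. \<forall>h. 0 < h \<and> h < d \<longrightarrow>
       norm (integral (cbox x (x + h *\<^sub>R One)) g /\<^sub>R h ^ DIM(real) - g x) < e"
    using integrable_ccontinuous_explicit[of g, OF g] by blast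
  obtain N2 where N2: "negligible N2"
    "\<And>x e. \<lbrakk>x \<notin> N2; 0 < e\<rbrakk> \<Longrightarrow> \<exists>d>0. \<forall>h. 0 < h \<and> h < d \<longrightarrow>
       norm (integral (cbox x (x + h *\<^sub>R One)) (\<lambda>x. g (- x)) /\<^sub>R h ^ DIM(real) - g (- x)) < e"
    using integrable_ccontinuous_explicit[of "\<lambda>x. g (- x)", OF g'] by blast
  show thesis
  proof
    show "negligible (N1 \<union> uminus ` N2)"
      using N1(1) negligible_differentiable_image_negligible[where f=uminus and S=N2] N2(1)
      by (auto intro!: differentiable_on_minus differentiable_on_ident)
  next
    fix t assume t: "a < t" "t < b" "t \<notin> N1 \<union> uminus ` N2"
    have tN: "t \<notin> N1" "- t \<notin> N2" using t(3) by (auto simp: image_iff)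
    let ?F = "\<lambda>s. integral {a..s} f"
    have step: "?F v - ?F u = integral {u..v} g" if "a \<le> u" "u \<le> v" "v \<le> b" for u v
    proof -
      have "?F u + integral {u..v} f = ?F v"
        by (rule Henstock_Kurzweil_Integration.integral_combine)
           (use that integrable_subinterval_real[OF f] in auto)
      moreover have "integral {u..v} f = integral {u..v} g"
        by (rule Henstock_Kurzweil_Integration.integral_cong) (use that in \<open>auto simp: g_def\<close>)
      ultimately show ?thesis by simp
    qed
    have gt: "g t = f t" using t by (simp add: g_def)
    show "(?F has_real_derivative f t) (at t)"
      unfolding DERIV_def LIM_def
    proof (intro allI impI)
      fix e :: real assume e: "0 < e"
      obtain d1 where d1: "d1 > 0" "\<And>h. 0 < h \<Longrightarrow> h < d1 \<Longrightarrow> \<bar>integral {t..t+h} g / h - f t\<bar> < e"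
        using N1(2)[OF tN(1) e] gt by (auto simp: divide_inverse mult.commute)
      obtain d2 where d2: "d2 > 0"
        "\<And>h. 0 < h \<Longrightarrow> h < d2 \<Longrightarrow> \<bar>integral {-t..-t+h} (\<lambda>x. g (- x)) / h - f t\<bar> < e"
        using N2(2)[OF tN(2) e] gt by (auto simp: divide_inverse mult.commute)
      show "\<exists>d>0. \<forall>h::real. h \<noteq> 0 \<and> dist h 0 < d \<longrightarrow> dist ((?F (t + h) - ?F t) / h) (f t) < e"
      proof (intro exI conjI allI impI)
        show "min (min d1 d2) (min (t - a) (b - t)) > 0" using d1 d2 t by auto
        fix h :: real assume h: "h \<noteq> 0 \<and> dist h 0 < min (min d1 d2) (min (t - a) (b - t))"
        show "dist ((?F (t + h) - ?F t) / h) (f t) < e"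
        proof (cases "h > 0")
          case True
          then have "?F (t + h) - ?F t = integral {t..t+h} g"
            using h t by (intro step) auto
          then show ?thesis using d1(2)[of h] True h by (simp add: dist_real_def)
        next
          case False
          then have "?F t - ?F (t + h) = integral {t+h..t} g"
            using h t by (intro step) auto
          also have "\<dots> = integral {-t..-t+(-h)} (\<lambda>x. g (- x))"
            using Henstock_Kurzweil_Integration.integral_reflect_real[where f=g and a="t+h" and b=t] by (simp add: add.commute)
          finally have "(?F (t + h) - ?F t) / h = integral {-t..-t+(-h)} (\<lambda>x. g (- x)) / (-h)"
            by (simp add: field_simps)
          then show ?thesis using d2(2)[of "-h"] False h by (simp add: dist_real_def)
        qed
      qed
    qed
  qed
qed

text \<open>Absolute continuity of the integral, with an open set so that each point of
  \<open>N\<close> has a whole neighbourhood in it. The open covers \<open>T n\<close> are unrelated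
  to each other; their finite intersections stay open and decrease to a null set, and dominated
  convergence applies.\<close>

lemma negligible_small_integral:
  fixes h :: "real \<Rightarrow> real"
  assumes h: "h integrable_on {a..b}" "\<And>t. 0 \<le> h t" and N: "negligible N" and e: "0 < e"
  obtains U where "open U" "N \<subseteq> U" "(\<lambda>t. if t \<in> U then h t else 0) integrable_on {a..b}"
    "integral {a..b} (\<lambda>t. if t \<in> U then h t else 0) < e"
proof -
  have "\<exists>T. open T \<and> N \<subseteq> T \<and> T \<in> lmeasurable \<and> measure lebesgue T < inverse (Suc n)" for n :: nat
  proof -
    obtain T where T: "open T" "N \<subseteq> T" "T - N \<in> lmeasurable" "emeasure lebesgue (T - N) < ennreal (inverse (Suc n))"
      using sets_lebesgue_outer_open[of N "inverse (Suc n)"] negligible_imp_sets[OF N] by auto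
    have TN: "T = (T - N) \<union> N" using \<open>N \<subseteq> T\<close> by auto
    have "T \<in> lmeasurable"
      using fmeasurable.Un[OF T(3) negligible_imp_measurable[OF N]] TN by simp
    moreover have "measure lebesgue T = measure lebesgue (T - N)"
      using TN measure_Un_null_set[of "T - N" lebesgue N] N T(3)
      by (metis fmeasurableD negligible_iff_null_sets)
    moreover have "measure lebesgue (T - N) < inverse (Suc n)"
      using T(3,4) by (simp add: emeasure_eq_measure2 ennreal_less_iff)
    ultimately show ?thesis using T(1,2) by auto
  qed
  then obtain T where T: "\<And>n. open (T n)" "\<And>n. N \<subseteq> T n" "\<And>n. T n \<in> lmeasurable"
    "\<And>n::nat. measure lebesgue (T n) < inverse (Suc n)" by metis
  define V where "V n = (\<Inter>k\<le>n. T k)" for n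
  define M where "M = (\<Inter>k. T k)"
  have V: "open (V n)" "N \<subseteq> V n" for n using T by (auto simp: V_def)
  have M: "negligible M"
    unfolding negligible_outer
  proof (intro allI impI)
    fix r :: real assume "0 < r"
    then obtain n where "inverse (Suc n) < r" using reals_Archimedean by blast
    then show "\<exists>S. M \<subseteq> S \<and> S \<in> lmeasurable \<and> measure lebesgue S < r"
      using T(3,4)[of n] by (intro exI[of _ "T n"]) (auto simp: M_def)
  qed
  have absh: "h absolutely_integrable_on {a..b}"
    using h by (intro nonnegative_absolutely_integrable_1) auto
  have int: "(\<lambda>t. if t \<in> V n then h t else 0) integrable_on {a..b}" for n
  proof -
    have "h absolutely_integrable_on {a..b} \<inter> V n"
      by (rule set_integrable_subset[OF absh]) (use V in \<open>auto intro: borel_open\<close>)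
    then have "h integrable_on ({a..b} \<inter> V n)"
      by (rule set_lebesgue_integral_eq_integral)
    then show ?thesis by (simp add: integrable_restrict_Int Int_commute)
  qed
  have "(\<lambda>n. integral {a..b} (\<lambda>t. if t \<in> V n then h t else 0)) \<longlonglongrightarrow>
        integral {a..b} (\<lambda>t. if t \<in> M then h t else 0)"
  proof (rule dominated_convergence(2)[OF int h(1)])
    show "norm (if t \<in> V n then h t else 0) \<le> h t" for n t using h(2) by auto
    show "(\<lambda>n. if t \<in> V n then h t else 0) \<longlonglongrightarrow> (if t \<in> M then h t else 0)" for t
    proof (cases "t \<in> M")
      case True then show ?thesis by (auto simp: V_def M_def)
    next
      case False
      then obtain k where "t \<notin> T k" by (auto simp: M_def)
      then have "eventually (\<lambda>n. (if t \<in> V n then h t else 0) = 0) sequentially"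
        by (intro eventually_sequentiallyI[of k]) (auto simp: V_def)
      then show ?thesis using False by (simp add: tendsto_eventually)
    qed
  qed
  moreover have "integral {a..b} (\<lambda>t. if t \<in> M then h t else 0) = 0"
    by (rule integral_unique, rule has_integral_negligible[OF M]) auto
  ultimately have "eventually (\<lambda>n. integral {a..b} (\<lambda>t. if t \<in> V n then h t else 0) < e) sequentially"
    using e by (simp add: order_tendstoD)
  then obtain n where "integral {a..b} (\<lambda>t. if t \<in> V n then h t else 0) < e"
    by (auto simp: eventually_sequentially)
  then show thesis using that V int by blast
qed

text \<open>This is absolute continuity in disguise: for an absolutely continuous \<open>G\<close>
  take \<open>h\<close> to be the absolute value of the derivative. The dominating \<open>h\<close>
  makes sums, products and compositions easy and is what the monotonicity proof consumes.\<close>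

definition dominated_increments :: "(real \<Rightarrow> real) \<Rightarrow> real \<Rightarrow> real \<Rightarrow> bool" where
  "dominated_increments G a b \<longleftrightarrow> (\<exists>h. h integrable_on {a..b} \<and> (\<forall>t. 0 \<le> h t) \<and>
     (\<forall>u v. a \<le> u \<and> u \<le> v \<and> v \<le> b \<longrightarrow> \<bar>G v - G u\<bar> \<le> integral {u..v} h))"

text \<open>On a small open set around the points without derivative information, the whole
  increment of \<open>G\<close> is charged to \<open>h\<close>, whose integral there is below
  \<open>e\<close>. Elsewhere the derivative leaves only an error of slope \<open>e\<close>. Then
  \<open>e\<close> tends to 0.\<close>

lemma dominated_increments_nonincreasing:
  assumes G: "dominated_increments G a b" and ab: "a \<le> b" and N: "negligible N"
    and der: "\<And>t. \<lbrakk>a < t; t < b; t \<notin> N\<rbrakk> \<Longrightarrow> \<exists>D\<le>0. (G has_real_derivative D) (at t)"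
  shows "G b \<le> G a"
proof -
  obtain h where h: "h integrable_on {a..b}" "\<And>t. 0 \<le> h t"
    and Gh: "\<And>u v. \<lbrakk>a \<le> u; u \<le> v; v \<le> b\<rbrakk> \<Longrightarrow> \<bar>G v - G u\<bar> \<le> integral {u..v} h"
    using G by (auto simp: dominated_increments_def)
  \<comment> \<open>No derivative is assumed at the end points, so they join the exceptional
    set.\<close>
  have N': "negligible (N \<union> {a, b})" using N by auto
  have *: "G b \<le> G a + e * (b - a + 1)" if e: "0 < e" for e
  proof -
    obtain U where U: "open U" "N \<union> {a, b} \<subseteq> U"
      and hU: "(\<lambda>t. if t \<in> U then h t else 0) integrable_on {a..b}"
        "integral {a..b} (\<lambda>t. if t \<in> U then h t else 0) < e"
      using negligible_small_integral[OF h N' e] by blast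
    let ?hU = "\<lambda>t. if t \<in> U then h t else 0"
    define H where "H t = integral {a..t} ?hU" for t
    have H: "H v - H u = integral {u..v} ?hU" if "a \<le> u" "u \<le> v" "v \<le> b" for u v
      unfolding H_def
      using Henstock_Kurzweil_Integration.integral_combine[of a u v ?hU]
        integrable_subinterval_real[OF hU(1), of a v] that by force
    have Hmono: "H u \<le> H v" if "a \<le> u" "u \<le> v" "v \<le> b" for u v
    proof -
      have "0 \<le> integral {u..v} ?hU"
        by (rule Henstock_Kurzweil_Integration.integral_nonneg)
           (use that h integrable_subinterval_real[OF hU(1)] in auto)
      then show ?thesis using H[OF that] by simp
    qed
    define K where "K t = G t - H t - e * t" for t
    \<comment> \<open>Compactness enters by bisection: the inequality for \<open>K\<close> chains
      over adjacent intervals, so it suffices on all short intervals around each point. The order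
      constraints are part of the predicate, which explains the trivial conjuncts.\<close>
    have "a \<le> a \<and> a \<le> b \<and> b \<le> b \<longrightarrow> K b \<le> K a"
    proof (rule Bolzano[OF ab, where P = "\<lambda>u v. a \<le> u \<and> u \<le> v \<and> v \<le> b \<longrightarrow> K v \<le> K u"])
      fix x assume x: "a \<le> x" "x \<le> b"
      show "\<exists>d>0. \<forall>u v. u \<le> x \<and> x \<le> v \<and> v - u < d \<longrightarrow> (a \<le> u \<and> u \<le> v \<and> v \<le> b \<longrightarrow> K v \<le> K u)"
      proof (cases "x \<in> U")
        case True
        then obtain d where d: "d > 0" "ball x d \<subseteq> U" using U(1) openE by blast
        show ?thesis
        proof (intro exI[of _ d] conjI allI impI d(1))
          fix u v assume uv: "u \<le> x \<and> x \<le> v \<and> v - u < d" "a \<le> u \<and> u \<le> v \<and> v \<le> b"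
          have "{u..v} \<subseteq> ball x d" using uv by (auto simp: dist_real_def)
          then have "integral {u..v} ?hU = integral {u..v} h"
            using d(2) by (intro Henstock_Kurzweil_Integration.integral_cong) auto
          then have "G v - G u \<le> H v - H u" using Gh[of u v] H[of u v] uv by auto
          moreover have "e * u \<le> e * v" using uv e by simp
          ultimately show "K v \<le> K u" by (simp add: K_def)
        qed
      next
        case False
        then have "a < x" "x < b" "x \<notin> N" using U(2) x by (auto simp: less_le)
        then obtain D where D: "D \<le> 0" "(G has_derivative (\<lambda>y. y * D)) (at x)"
          using der[of x] by (metis has_field_derivative_imp_has_derivative mult_commute_abs)
        then obtain d where d: "d > 0" "\<And>y. \<bar>y - x\<bar> < d \<Longrightarrow> \<bar>G y - G x - (y - x) * D\<bar> \<le> e * \<bar>y - x\<bar>"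
          using e unfolding has_derivative_at_alt by auto
        show ?thesis
        proof (intro exI[of _ d] conjI allI impI d(1))
          fix u v assume uv: "u \<le> x \<and> x \<le> v \<and> v - u < d" "a \<le> u \<and> u \<le> v \<and> v \<le> b"
          have "G v - G x \<le> e * (v - x) + (v - x) * D" using d(2)[of v] uv by (auto simp: abs_le_iff)
          moreover have "G x - G u \<le> e * (x - u) + (x - u) * D" using d(2)[of u] uv
            by (auto simp: abs_le_iff algebra_simps)
          moreover have "(v - x) * D \<le> 0" "(x - u) * D \<le> 0"
            using uv D(1) by (auto intro!: mult_nonneg_nonpos)
          ultimately have "G v - G u \<le> e * v - e * u" by (simp add: algebra_simps)
          then show "K v \<le> K u" using Hmono[of u v] uv by (simp add: K_def)
        qed
      qed
    qed auto
    then have "G b \<le> G a + (H b - H a) + e * (b - a)"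
      using ab by (simp add: K_def algebra_simps)
    moreover have "H b - H a < e" using hU(2) by (simp add: H_def)
    ultimately show ?thesis by (simp add: algebra_simps)
  qed
  show ?thesis
  proof (rule field_le_epsilon)
    fix e :: real assume "0 < e"
    then have "0 < e / (b - a + 1)" "e / (b - a + 1) * (b - a + 1) = e" using ab by auto
    with *[of "e / (b - a + 1)"] show "G b \<le> G a + e" by simp
  qed
qed

section \<open>Closure properties of absolute continuity\<close>

lemma dominated_increments_add:
  assumes "dominated_increments F a b" "dominated_increments G a b"
  shows "dominated_increments (\<lambda>t. F t + G t) a b"
proof -
  obtain f where f: "f integrable_on {a..b}" "\<And>t. 0 \<le> f t"
    "\<And>u v. \<lbrakk>a \<le> u; u \<le> v; v \<le> b\<rbrakk> \<Longrightarrow> \<bar>F v - F u\<bar> \<le> integral {u..v} f"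
    using assms(1) by (auto simp: dominated_increments_def)
  obtain g where g: "g integrable_on {a..b}" "\<And>t. 0 \<le> g t"
    "\<And>u v. \<lbrakk>a \<le> u; u \<le> v; v \<le> b\<rbrakk> \<Longrightarrow> \<bar>G v - G u\<bar> \<le> integral {u..v} g"
    using assms(2) by (auto simp: dominated_increments_def)
  have "\<bar>F v + G v - (F u + G u)\<bar> \<le> integral {u..v} (\<lambda>t. f t + g t)"
    if uv: "a \<le> u" "u \<le> v" "v \<le> b" for u v
  proof -
    have "integral {u..v} (\<lambda>t. f t + g t) = integral {u..v} f + integral {u..v} g"
      by (rule Henstock_Kurzweil_Integration.integral_add)
         (use uv integrable_subinterval_real[OF f(1)] integrable_subinterval_real[OF g(1)] in auto)
    then show ?thesis using f(3)[OF uv] g(3)[OF uv] by linarith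
  qed
  then show ?thesis
    unfolding dominated_increments_def
    using f g by (intro exI[of _ "\<lambda>t. f t + g t"]) (auto intro: integrable_add)
qed

lemma dominated_increments_bounded:
  assumes "dominated_increments F a b"
  obtains M where "0 \<le> M" "\<And>t. t \<in> {a..b} \<Longrightarrow> \<bar>F t\<bar> \<le> M"
proof -
  obtain f where f: "f integrable_on {a..b}" "\<And>t. 0 \<le> f t"
    "\<And>u v. \<lbrakk>a \<le> u; u \<le> v; v \<le> b\<rbrakk> \<Longrightarrow> \<bar>F v - F u\<bar> \<le> integral {u..v} f"
    using assms by (auto simp: dominated_increments_def)
  have nonneg: "0 \<le> integral {a..b} f"
    by (rule Henstock_Kurzweil_Integration.integral_nonneg) (use f in auto)
  have "\<bar>F t\<bar> \<le> \<bar>F a\<bar> + integral {a..b} f" if t: "t \<in> {a..b}" for t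
  proof -
    have "integral {a..t} f \<le> integral {a..b} f"
      by (rule integral_subset_le) (use t f integrable_subinterval_real[OF f(1)] in auto)
    then show ?thesis using f(3)[of a t] t by auto
  qed
  then show thesis using that[of "\<bar>F a\<bar> + integral {a..b} f"] nonneg by auto
qed

lemma dominated_increments_mult:
  assumes "dominated_increments F a b" "dominated_increments G a b"
  shows "dominated_increments (\<lambda>t. F t * G t) a b"
proof -
  obtain f where f: "f integrable_on {a..b}" "\<And>t. 0 \<le> f t"
    "\<And>u v. \<lbrakk>a \<le> u; u \<le> v; v \<le> b\<rbrakk> \<Longrightarrow> \<bar>F v - F u\<bar> \<le> integral {u..v} f"
    using assms(1) by (auto simp: dominated_increments_def)
  obtain g where g: "g integrable_on {a..b}" "\<And>t. 0 \<le> g t"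
    "\<And>u v. \<lbrakk>a \<le> u; u \<le> v; v \<le> b\<rbrakk> \<Longrightarrow> \<bar>G v - G u\<bar> \<le> integral {u..v} g"
    using assms(2) by (auto simp: dominated_increments_def)
  obtain M where M: "0 \<le> M" "\<And>t. t \<in> {a..b} \<Longrightarrow> \<bar>F t\<bar> \<le> M"
    using dominated_increments_bounded[OF assms(1)] by blast
  obtain K where K: "0 \<le> K" "\<And>t. t \<in> {a..b} \<Longrightarrow> \<bar>G t\<bar> \<le> K"
    using dominated_increments_bounded[OF assms(2)] by blast
  let ?h = "\<lambda>t. K * f t + M * g t"
  have "\<bar>F v * G v - F u * G u\<bar> \<le> integral {u..v} ?h"
    if uv: "a \<le> u" "u \<le> v" "v \<le> b" for u v
  proof -
    have "integral {u..v} ?h = K * integral {u..v} f + M * integral {u..v} g"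
      by (subst Henstock_Kurzweil_Integration.integral_add)
         (use uv integrable_subinterval_real[OF f(1)] integrable_subinterval_real[OF g(1)]
           in \<open>auto intro!: integrable_on_mult_right\<close>)
    moreover have "F v * G v - F u * G u = (F v - F u) * G v + F u * (G v - G u)"
      by (simp add: algebra_simps)
    moreover have "\<bar>(F v - F u) * G v\<bar> \<le> K * integral {u..v} f"
      unfolding abs_mult using f(3)[OF uv] K uv by (subst mult.commute) (intro mult_mono, auto)
    moreover have "\<bar>F u * (G v - G u)\<bar> \<le> M * integral {u..v} g"
      unfolding abs_mult using g(3)[OF uv] M uv by (intro mult_mono) auto
    ultimately show ?thesis by linarith
  qed
  moreover have "?h integrable_on {a..b}"
    using f g by (intro integrable_add integrable_on_mult_right)
  ultimately show ?thesis
    unfolding dominated_increments_def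
    using f g M K by (intro exI[of _ ?h]) auto
qed

lemma dominated_increments_const: "dominated_increments (\<lambda>t. c) a b"
  unfolding dominated_increments_def by (intro exI[of _ "\<lambda>_. 0"]) auto

lemma dominated_increments_diff:
  assumes "dominated_increments F a b" "dominated_increments G a b"
  shows "dominated_increments (\<lambda>t. F t - G t) a b"
  using dominated_increments_add[OF assms(1)
      dominated_increments_mult[OF dominated_increments_const[of "-1"] assms(2)]]
  by simp

text \<open>\<open>F\<close> is Lipschitz on the compact interval containing the values of
  \<open>S\<close>. This is used with \<open>S\<close> the arc length and \<open>F\<close> a
  component of the geodesic.\<close>

lemma dominated_increments_compose:
  assumes S: "dominated_increments S a b" and range: "\<And>t. t \<in> {a..b} \<Longrightarrow> S t \<in> {p..q}"
    and der: "\<And>s. s \<in> {p..q} \<Longrightarrow> (F has_real_derivative F' s) (at s)"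
    and cont: "continuous_on {p..q} F'"
  shows "dominated_increments (\<lambda>t. F (S t)) a b"
proof -
  obtain f where f: "f integrable_on {a..b}" "\<And>t. 0 \<le> f t"
    "\<And>u v. \<lbrakk>a \<le> u; u \<le> v; v \<le> b\<rbrakk> \<Longrightarrow> \<bar>S v - S u\<bar> \<le> integral {u..v} f"
    using S by (auto simp: dominated_increments_def)
  have "bounded (F' ` {p..q})"
    by (rule compact_imp_bounded, rule compact_continuous_image[OF cont]) auto
  then obtain M where M: "0 < M" "\<And>s. s \<in> {p..q} \<Longrightarrow> \<bar>F' s\<bar> \<le> M"
    unfolding bounded_pos by auto
  have lip: "\<bar>F s - F r\<bar> \<le> M * \<bar>s - r\<bar>" if "s \<in> {p..q}" "r \<in> {p..q}" for s r
    using field_differentiable_bound[of "{p..q}" F F' M s r] der M(2) that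
    by (auto intro: has_field_derivative_at_within)
  have "\<bar>F (S v) - F (S u)\<bar> \<le> integral {u..v} (\<lambda>t. M * f t)"
    if uv: "a \<le> u" "u \<le> v" "v \<le> b" for u v
  proof -
    have "\<bar>F (S v) - F (S u)\<bar> \<le> M * \<bar>S v - S u\<bar>"
      using uv range by (intro lip) auto
    also have "\<dots> \<le> M * integral {u..v} f" using f(3)[OF uv] M by simp
    finally show ?thesis by simp
  qed
  then show ?thesis
    unfolding dominated_increments_def
    using f M by (intro exI[of _ "\<lambda>t. M * f t"]) (auto intro: integrable_on_mult_right)
qed

lemma dominated_increments_indefinite_integral:
  assumes f: "f absolutely_integrable_on {a..b}"
    and G: "\<And>t. t \<in> {a..b} \<Longrightarrow> G t = G a + integral {a..t} f"
  shows "dominated_increments G a b"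
proof -
  have i: "f integrable_on {a..b}" "(\<lambda>t. \<bar>f t\<bar>) integrable_on {a..b}"
    using f by (auto simp: absolutely_integrable_on_def)
  have "\<bar>G v - G u\<bar> \<le> integral {u..v} (\<lambda>t. \<bar>f t\<bar>)" if uv: "a \<le> u" "u \<le> v" "v \<le> b" for u v
  proof -
    have "integral {a..u} f + integral {u..v} f = integral {a..v} f"
      using uv integrable_subinterval_real[OF i(1)]
      by (intro Henstock_Kurzweil_Integration.integral_combine) auto
    then have "G v - G u = integral {u..v} f" using G[of u] G[of v] uv by simp
    moreover have "norm (integral {u..v} f) \<le> integral {u..v} (\<lambda>t. \<bar>f t\<bar>)"
      using uv integrable_subinterval_real[OF i(1)] integrable_subinterval_real[OF i(2)]
      by (intro integral_norm_bound_integral) auto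
    ultimately show ?thesis by simp
  qed
  then show ?thesis
    unfolding dominated_increments_def using i by (intro exI[of _ "\<lambda>t. \<bar>f t\<bar>"]) auto
qed

section \<open>Admissible curves\<close>

text \<open>On the axis the vertical term of the integrand is 0 because division by 0 yields 0,
  hence the condition \<open>c0\<close>.\<close>

lemma cc_length_eq:
  assumes T: "0 < T" and N: "negligible N"
    and der: "\<And>t. t \<in> {0..T} - N \<Longrightarrow> ((\<lambda>s. px (\<gamma> s)) has_real_derivative a t) (at t within {0..T})"
      "\<And>t. t \<in> {0..T} - N \<Longrightarrow> ((\<lambda>s. py (\<gamma> s)) has_real_derivative b t) (at t within {0..T})"
      "\<And>t. t \<in> {0..T} - N \<Longrightarrow> ((\<lambda>s. pz (\<gamma> s)) has_real_derivative c t * rad (\<gamma> t)) (at t within {0..T})"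
    and c0: "\<And>t. t \<in> {0..T} \<Longrightarrow> rad (\<gamma> t) = 0 \<Longrightarrow> c t = 0"
  shows "cc_length T \<gamma> = integral {0..T} (\<lambda>t. sqrt ((a t)\<^sup>2 + (b t)\<^sup>2 + (c t)\<^sup>2))"
  unfolding cc_length_def
proof (rule integral_spike[OF N])
  fix t assume t: "t \<in> {0..T} - N"
  have "((\<lambda>s. (px (\<gamma> s), py (\<gamma> s), pz (\<gamma> s))) has_vector_derivative (a t, b t, c t * rad (\<gamma> t)))
      (at t within {0..T})"
    using der[OF t] by (intro has_vector_derivative_Pair) (simp_all add: has_real_derivative_iff_has_vector_derivative)
  moreover have "(\<lambda>s. (px (\<gamma> s), py (\<gamma> s), pz (\<gamma> s))) = \<gamma>"
    by (simp add: px_def py_def pz_def)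
  ultimately have "vector_derivative \<gamma> (at t within {0..T}) = (a t, b t, c t * rad (\<gamma> t))"
    using vector_derivative_within_closed_interval[OF T, of t] t by auto
  then show "sqrt ((a t)\<^sup>2 + (b t)\<^sup>2 + (c t)\<^sup>2) =
      (let v = vector_derivative \<gamma> (at t within {0..T})
       in sqrt ((px v)\<^sup>2 + (py v)\<^sup>2 + (pz v)\<^sup>2 / (rad (\<gamma> t))\<^sup>2))"
    using c0[of t] t by (cases "rad (\<gamma> t) = 0") (auto simp: px_def py_def pz_def power_mult_distrib)
qed

lemma rad_square: "(rad q)\<^sup>2 = (px q)\<^sup>2 + (py q)\<^sup>2"
  by (simp add: rad_def)

lemma antiderivative_ae:
  fixes f :: "real \<Rightarrow> real"
  assumes f: "f integrable_on {a..b}"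
    and G: "\<And>t. t \<in> {a..b} \<Longrightarrow> G t = G a + integral {a..t} f"
  obtains N where "negligible N"
    "\<And>t. \<lbrakk>a < t; t < b; t \<notin> N\<rbrakk> \<Longrightarrow> (G has_real_derivative f t) (at t)"
proof -
  obtain N where N: "negligible N"
    "\<And>t. \<lbrakk>a < t; t < b; t \<notin> N\<rbrakk> \<Longrightarrow> ((\<lambda>s. integral {a..s} f) has_real_derivative f t) (at t)"
    using indefinite_integral_has_derivative_ae[OF f] by blast
  have "(G has_real_derivative f t) (at t)" if t: "a < t" "t < b" "t \<notin> N" for t
  proof (rule has_field_derivative_transform_within_open[where S = "{a<..<b}"])
    show "((\<lambda>s. G a + integral {a..s} f) has_real_derivative f t) (at t)"
      using N(2)[OF t] by (auto intro!: derivative_eq_intros)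
    show "G a + integral {a..s} f = G s" if "s \<in> {a<..<b}" for s
      using G[of s] that by simp
  qed (use t in auto)
  with N(1) that show thesis by blast
qed

lemma sq_integrable_absolutely_integrable:
  assumes "sq_integrable a {0..T}"
  shows "a absolutely_integrable_on {0..T}"
proof (rule measurable_bounded_by_integrable_imp_absolutely_integrable)
  show "a \<in> borel_measurable (lebesgue_on {0..T})"
    using assms by (simp add: sq_integrable_def measurable_on_iff_borel_measurable)
  show "(\<lambda>t. 1 + (a t)\<^sup>2) integrable_on {0..T}"
    using assms by (intro integrable_add) (auto simp: sq_integrable_def)
  show "norm (a t) \<le> 1 + (a t)\<^sup>2" for t
    using zero_le_power2[of "\<bar>a t\<bar> - 1"] zero_le_power2[of "a t"]
    unfolding power2_diff real_norm_def by (simp only: power2_abs power_one mult_1_right)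
qed simp

lemma admissible_rates:
  assumes "admissible T \<eta>"
  obtains a b c N where "negligible N"
    "\<forall>t\<in>{0<..<T} - N. ((\<lambda>s. px (\<eta> s)) has_real_derivative a t) (at t)"
    "\<forall>t\<in>{0<..<T} - N. ((\<lambda>s. py (\<eta> s)) has_real_derivative b t) (at t)"
    "\<forall>t\<in>{0<..<T} - N. ((\<lambda>s. pz (\<eta> s)) has_real_derivative c t * rad (\<eta> t)) (at t)"
    "dominated_increments (\<lambda>t. px (\<eta> t)) 0 T"
    "dominated_increments (\<lambda>t. py (\<eta> t)) 0 T"
    "dominated_increments (\<lambda>t. pz (\<eta> t)) 0 T"
    "\<forall>t. rad (\<eta> t) = 0 \<longrightarrow> c t = 0"
    "(\<lambda>t. sqrt ((a t)\<^sup>2 + (b t)\<^sup>2 + (c t)\<^sup>2)) absolutely_integrable_on {0..T}"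
proof -
  obtain a b c where sq: "sq_integrable a {0..T}" "sq_integrable b {0..T}" "sq_integrable c {0..T}"
    and x: "\<And>t. t \<in> {0..T} \<Longrightarrow> px (\<eta> t) = px (\<eta> 0) + integral {0..t} a"
    and y: "\<And>t. t \<in> {0..T} \<Longrightarrow> py (\<eta> t) = py (\<eta> 0) + integral {0..t} b"
    and z: "\<And>t. t \<in> {0..T} \<Longrightarrow> pz (\<eta> t) = pz (\<eta> 0) + integral {0..t} (\<lambda>s. c s * rad (\<eta> s))"
    using assms unfolding admissible_def by blast
  note abs = sq[THEN sq_integrable_absolutely_integrable]
  note int = abs[THEN absolutely_integrable_on_def[THEN iffD1], THEN conjunct1]
  have cont: "continuous_on {0..T} (\<lambda>t. px (\<eta> 0) + integral {0..t} a)"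
    "continuous_on {0..T} (\<lambda>t. py (\<eta> 0) + integral {0..t} b)"
    by (intro continuous_intros indefinite_integral_continuous_1 int)+
  have cont_x: "continuous_on {0..T} (\<lambda>t. px (\<eta> t))"
    by (rule continuous_on_eq[OF cont(1)]) (rule x[symmetric])
  have cont_y: "continuous_on {0..T} (\<lambda>t. py (\<eta> t))"
    by (rule continuous_on_eq[OF cont(2)]) (rule y[symmetric])
  have cont_rad: "continuous_on {0..T} (\<lambda>t. rad (\<eta> t))"
    unfolding rad_def by (intro continuous_on_real_sqrt continuous_on_add continuous_on_power cont_x cont_y)
  have rad_meas: "(\<lambda>t. rad (\<eta> t)) \<in> borel_measurable (lebesgue_on {0..T})"
    by (rule continuous_imp_measurable_on_sets_lebesgue[OF cont_rad]) simp
  have "bounded ((\<lambda>t. rad (\<eta> t)) ` {0..T})"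
    by (rule compact_imp_bounded, rule compact_continuous_image[OF cont_rad]) simp
  then have "(\<lambda>t. rad (\<eta> t) * c t) absolutely_integrable_on {0..T}"
    using rad_meas abs(3) by (intro absolutely_integrable_bounded_measurable_product_real) auto
  then have absz: "(\<lambda>t. c t * rad (\<eta> t)) absolutely_integrable_on {0..T}"
    by (simp add: mult.commute)
  then have intz: "(\<lambda>t. c t * rad (\<eta> t)) integrable_on {0..T}"
    by (simp add: absolutely_integrable_on_def)
  \<comment> \<open>The curve determines only \<open>c * rad\<close>, so \<open>c\<close> is
    arbitrary on the axis. The value 0 there leaves the curve unchanged and agrees with the
    integrand of \<open>cc_length\<close>.\<close>
  define c1 where "c1 t = (if rad (\<eta> t) = 0 then 0 else c t)" for t
  have c1: "c1 t * rad (\<eta> t) = c t * rad (\<eta> t)" for t by (simp add: c1_def)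
  obtain N1 where N1: "negligible N1"
    "\<And>t. \<lbrakk>0 < t; t < T; t \<notin> N1\<rbrakk> \<Longrightarrow> ((\<lambda>s. px (\<eta> s)) has_real_derivative a t) (at t)"
    using antiderivative_ae[OF int(1), of "\<lambda>s. px (\<eta> s)"] x by blast
  obtain N2 where N2: "negligible N2"
    "\<And>t. \<lbrakk>0 < t; t < T; t \<notin> N2\<rbrakk> \<Longrightarrow> ((\<lambda>s. py (\<eta> s)) has_real_derivative b t) (at t)"
    using antiderivative_ae[OF int(2), of "\<lambda>s. py (\<eta> s)"] y by blast
  obtain N3 where N3: "negligible N3"
    "\<And>t. \<lbrakk>0 < t; t < T; t \<notin> N3\<rbrakk> \<Longrightarrow>
       ((\<lambda>s. pz (\<eta> s)) has_real_derivative c t * rad (\<eta> t)) (at t)"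
    using antiderivative_ae[OF intz, of "\<lambda>s. pz (\<eta> s)"] z by blast
  have meas: "a \<in> borel_measurable (lebesgue_on {0..T})" "b \<in> borel_measurable (lebesgue_on {0..T})"
    "c \<in> borel_measurable (lebesgue_on {0..T})"
    using sq by (simp_all add: sq_integrable_def measurable_on_iff_borel_measurable)
  have "(\<lambda>t. sqrt ((a t)\<^sup>2 + (b t)\<^sup>2 + (c1 t)\<^sup>2)) absolutely_integrable_on {0..T}"
  proof (rule measurable_bounded_by_integrable_imp_absolutely_integrable)
    show "(\<lambda>t. sqrt ((a t)\<^sup>2 + (b t)\<^sup>2 + (c1 t)\<^sup>2)) \<in> borel_measurable (lebesgue_on {0..T})"
      unfolding c1_def using meas rad_meas by measurable
    show "(\<lambda>t. 1 + (a t)\<^sup>2 + (b t)\<^sup>2 + (c t)\<^sup>2) integrable_on {0..T}"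
      using sq by (intro integrable_add) (auto simp: sq_integrable_def)
    show "norm (sqrt ((a t)\<^sup>2 + (b t)\<^sup>2 + (c1 t)\<^sup>2)) \<le> 1 + (a t)\<^sup>2 + (b t)\<^sup>2 + (c t)\<^sup>2" for t
    proof -
      have "sqrt ((a t)\<^sup>2 + (b t)\<^sup>2 + (c1 t)\<^sup>2) \<le> sqrt ((1 + (a t)\<^sup>2 + (b t)\<^sup>2 + (c t)\<^sup>2)\<^sup>2)"
      proof (rule real_sqrt_le_mono)
        have "(c1 t)\<^sup>2 \<le> (c t)\<^sup>2" by (simp add: c1_def)
        moreover have "(a t)\<^sup>2 + (b t)\<^sup>2 + (c t)\<^sup>2 \<le> (1 + ((a t)\<^sup>2 + (b t)\<^sup>2 + (c t)\<^sup>2))\<^sup>2"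
          unfolding power2_sum[of 1] by simp
        ultimately show "(a t)\<^sup>2 + (b t)\<^sup>2 + (c1 t)\<^sup>2 \<le> (1 + (a t)\<^sup>2 + (b t)\<^sup>2 + (c t)\<^sup>2)\<^sup>2"
          by (simp add: add.assoc)
      qed
      then show ?thesis by simp
    qed
  qed simp
  then show thesis
  proof (rule that[of "N1 \<union> N2 \<union> N3" a b c1, rotated 8])
    show "negligible (N1 \<union> N2 \<union> N3)" using N1(1) N2(1) N3(1) by simp
    show "\<forall>t\<in>{0<..<T} - (N1 \<union> N2 \<union> N3). ((\<lambda>s. px (\<eta> s)) has_real_derivative a t) (at t)"
      using N1(2) by simp
    show "\<forall>t\<in>{0<..<T} - (N1 \<union> N2 \<union> N3). ((\<lambda>s. py (\<eta> s)) has_real_derivative b t) (at t)"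
      using N2(2) by simp
    show "\<forall>t\<in>{0<..<T} - (N1 \<union> N2 \<union> N3).
        ((\<lambda>s. pz (\<eta> s)) has_real_derivative c1 t * rad (\<eta> t)) (at t)"
      unfolding c1 using N3(2) by simp
    show "dominated_increments (\<lambda>t. px (\<eta> t)) 0 T"
      by (rule dominated_increments_indefinite_integral[OF abs(1)]) (rule x)
    show "dominated_increments (\<lambda>t. py (\<eta> t)) 0 T"
      by (rule dominated_increments_indefinite_integral[OF abs(2)]) (rule y)
    show "dominated_increments (\<lambda>t. pz (\<eta> t)) 0 T"
      by (rule dominated_increments_indefinite_integral[OF absz]) (rule z)
    show "\<forall>t. rad (\<eta> t) = 0 \<longrightarrow> c1 t = 0" by (simp add: c1_def)
  qed
qed

text \<open>Derivatives within the interval are enough, which suits a height defined as an integral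
  from 0.\<close>

lemma smooth_admissible:
  assumes T: "0 \<le> T"
    and der: "\<And>t. t \<in> {0..T} \<Longrightarrow> ((\<lambda>s. px (\<gamma> s)) has_real_derivative a t) (at t within {0..T})"
      "\<And>t. t \<in> {0..T} \<Longrightarrow> ((\<lambda>s. py (\<gamma> s)) has_real_derivative b t) (at t within {0..T})"
      "\<And>t. t \<in> {0..T} \<Longrightarrow> ((\<lambda>s. pz (\<gamma> s)) has_real_derivative c t * rad (\<gamma> t)) (at t within {0..T})"
    and cont: "continuous_on {0..T} a" "continuous_on {0..T} b" "continuous_on {0..T} c"
  shows "admissible T \<gamma>"
proof -
  have ftc: "F t = F 0 + integral {0..t} f"
    if "\<And>t. t \<in> {0..T} \<Longrightarrow> (F has_real_derivative f t) (at t within {0..T})" "t \<in> {0..T}" for F f t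
  proof -
    have "(f has_integral F t - F 0) {0..t}"
    proof (rule fundamental_theorem_of_calculus)
      fix s assume "s \<in> {0..t}"
      then have "(F has_real_derivative f s) (at s within {0..t})"
        using that by (intro DERIV_subset[OF that(1)]) auto
      then show "(F has_vector_derivative f s) (at s within {0..t})"
        by (simp add: has_real_derivative_iff_has_vector_derivative)
    qed (use that in simp)
    then show ?thesis by (simp add: integral_unique)
  qed
  have sq: "sq_integrable f {0..T}" if "continuous_on {0..T} f" for f
    unfolding sq_integrable_def
    using that by (auto simp: measurable_on_iff_borel_measurable
        intro!: continuous_imp_measurable_on_sets_lebesgue integrable_continuous_interval continuous_intros)
  show ?thesis
    unfolding admissible_def
    by (intro conjI T exI[of _ a] exI[of _ b] exI[of _ c] ballI sq cont) (rule ftc[OF der(1)] ftc[OF der(2)] ftc[OF der(3)], assumption+)+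
qed

section \<open>Calibration of the geodesics\<close>

text \<open>Cauchy--Schwarz followed by the arithmetic-geometric mean inequality. It bounds the
  pairing of a momentum with a velocity by the speed times (Hamiltonian + 1/2).\<close>

lemma linear_form_le_length:
  fixes a b c p q m :: real
  shows "p * a + q * b + m * c \<le> sqrt (a\<^sup>2 + b\<^sup>2 + c\<^sup>2) * ((p\<^sup>2 + q\<^sup>2 + m\<^sup>2 + 1) / 2)"
proof -
  have "(p * a + q * b + m * c)\<^sup>2 \<le> (a\<^sup>2 + b\<^sup>2 + c\<^sup>2) * (p\<^sup>2 + q\<^sup>2 + m\<^sup>2)"
    using sum_squares_ge_zero[of "p * b - q * a" "p * c - m * a"] zero_le_power2[of "q * c - m * b"]
    by (simp add: power2_eq_square algebra_simps)
  then have "p * a + q * b + m * c \<le> sqrt (a\<^sup>2 + b\<^sup>2 + c\<^sup>2) * sqrt (p\<^sup>2 + q\<^sup>2 + m\<^sup>2)"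
    by (metis real_le_rsqrt real_sqrt_mult)
  also have "sqrt (p\<^sup>2 + q\<^sup>2 + m\<^sup>2) \<le> (p\<^sup>2 + q\<^sup>2 + m\<^sup>2 + 1) / 2"
    using arith_geo_mean_sqrt[of "p\<^sup>2 + q\<^sup>2 + m\<^sup>2" 1] by simp
  then have "sqrt (a\<^sup>2 + b\<^sup>2 + c\<^sup>2) * sqrt (p\<^sup>2 + q\<^sup>2 + m\<^sup>2)
    \<le> sqrt (a\<^sup>2 + b\<^sup>2 + c\<^sup>2) * ((p\<^sup>2 + q\<^sup>2 + m\<^sup>2 + 1) / 2)"
    by (intro mult_left_mono) auto
  finally show ?thesis .
qed

text \<open>The left side is what the product and chain rules produce, with \<open>k\<close> the
  curvature, \<open>l\<close> the rate of the clock and \<open>a\<close>, \<open>b\<close>,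
  \<open>d\<close> the rates of the competitor. The two sides differ by a multiple of the energy
  defect of the geodesic.\<close>

lemma calibration_identity:
  fixes U V k X Y x y a b d l w :: real
  assumes "U\<^sup>2 + V\<^sup>2 + w\<^sup>2 * (X\<^sup>2 + Y\<^sup>2) = 1"
  shows "- (w\<^sup>2 * X) * l * (x - X) + (a - U * l) * U
    + (- (w\<^sup>2 * Y) * l * (y - Y) + (b - V * l) * V)
    + (- (w\<^sup>2 + k\<^sup>2) * l / 2 * ((x - X) * (x - X) + (y - Y) * (y - Y))
      + ((a - U * l) * (x - X) + (a - U * l) * (x - X) + ((b - V * l) * (y - Y) + (b - V * l) * (y - Y))) * (k / 2))
    + w * (d - w * (X\<^sup>2 + Y\<^sup>2) * l) =
    (U + k * (x - X)) * a + (V + k * (y - Y)) * b + w * d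
      - l * (((U + k * (x - X))\<^sup>2 + (V + k * (y - Y))\<^sup>2 + w\<^sup>2 * (x\<^sup>2 + y\<^sup>2) + 1) / 2)" 
    (is "?lhs = ?rhs")
proof -
  have "?lhs - ?rhs = l / 2 * (1 - (U\<^sup>2 + V\<^sup>2 + w\<^sup>2 * (X\<^sup>2 + Y\<^sup>2)))"
    by (simp add: power2_eq_square algebra_simps add_divide_distrib diff_divide_distrib)
  then show ?thesis using assms by simp
qed

locale unit_geodesic =
  fixes X Y Z U V :: "real \<Rightarrow> real" and w :: real
  assumes X': "(X has_real_derivative U t) (at t)"
    and Y': "(Y has_real_derivative V t) (at t)"
    and Z': "(Z has_real_derivative w * ((X t)\<^sup>2 + (Y t)\<^sup>2)) (at t)"
    and U': "(U has_real_derivative - (w\<^sup>2 * X t)) (at t)"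
    and V': "(V has_real_derivative - (w\<^sup>2 * Y t)) (at t)"
    and energy_0: "(U 0)\<^sup>2 + (V 0)\<^sup>2 + w\<^sup>2 * ((X 0)\<^sup>2 + (Y 0)\<^sup>2) = 1"
begin

lemma energy: "(U t)\<^sup>2 + (V t)\<^sup>2 + w\<^sup>2 * ((X t)\<^sup>2 + (Y t)\<^sup>2) = 1"
proof -
  have "((\<lambda>t. (U t)\<^sup>2 + (V t)\<^sup>2 + w\<^sup>2 * ((X t)\<^sup>2 + (Y t)\<^sup>2)) has_real_derivative 0) (at t)" for t
    by (auto intro!: derivative_eq_intros X' Y' U' V' simp: algebra_simps)
  then have "\<forall>t. ((\<lambda>t. (U t)\<^sup>2 + (V t)\<^sup>2 + w\<^sup>2 * ((X t)\<^sup>2 + (Y t)\<^sup>2)) has_real_derivative 0) (at t)"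
    by blast
  from DERIV_isconst_all[OF this, of t 0] energy_0 show ?thesis by simp
qed

definition trajectory :: "real \<Rightarrow> pt" where
  "trajectory t = (X t, Y t, Z t)"

text \<open>In the plane, the oscillator Lagrangian \<open>(|v|\<^sup>2 - w\<^sup>2|x|\<^sup>2)/2\<close> has the
  Hamilton--Jacobi solution \<open>W(x, s)\<close> that is quadratic about the geodesic with Hessian
  \<open>curvature T s\<close>, a solution of the Riccati equation \<open>\<alpha>' = - \<alpha>\<^sup>2 - w\<^sup>2\<close> without poles
  on \<open>[0, T]\<close> as long as \<open>|w| T < \<pi>\<close>. The function below is \<open>W + w z - s/2\<close>.\<close>

definition curvature :: "real \<Rightarrow> real \<Rightarrow> real" where
  "curvature T s = - w * tan (w * (s - T / 2))"

definition calibration :: "real \<Rightarrow> real \<Rightarrow> real \<Rightarrow> real \<Rightarrow> real \<Rightarrow> real" where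
  "calibration T s x y z = U s * (x - X s) + V s * (y - Y s)
     + curvature T s / 2 * ((x - X s) * (x - X s) + (y - Y s) * (y - Y s)) + w * (z - Z s)"

text \<open>Centring the tangent at \<open>T / 2\<close> makes its argument sweep a symmetric
  interval of length \<open>|w| T\<close>, which fits strictly between the poles at
  \<open>- pi / 2\<close> and \<open>pi / 2\<close>.\<close>

lemma cos_nonzero:
  assumes "\<bar>w\<bar> * T < pi" "s \<in> {0..T}"
  shows "cos (w * (s - T / 2)) \<noteq> 0"
proof -
  have "\<bar>w * (s - T / 2)\<bar> \<le> \<bar>w\<bar> * (T / 2)"
    unfolding abs_mult using assms(2) by (intro mult_left_mono) (auto simp: abs_if)
  then have "- (pi / 2) < w * (s - T / 2)" "w * (s - T / 2) < pi / 2"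
    using assms(1) by linarith+
  then show ?thesis using cos_gt_zero_pi[of "w * (s - T / 2)"] by simp
qed

lemma curvature_deriv:
  assumes "\<bar>w\<bar> * T < pi" "s \<in> {0..T}"
  shows "(curvature T has_real_derivative - (w\<^sup>2 + (curvature T s)\<^sup>2)) (at s)"
proof -
  note nz = cos_nonzero[OF assms]
  have "((\<lambda>s. w * (s - T / 2)) has_real_derivative w) (at s)"
    by (auto intro!: derivative_eq_intros)
  from DERIV_cmult[OF DERIV_chain2[OF DERIV_tan[OF nz] this], of "- w"]
  have "(curvature T has_real_derivative - w * (inverse ((cos (w * (s - T / 2)))\<^sup>2) * w)) (at s)"
    unfolding curvature_def[abs_def] .
  moreover have "inverse ((cos (w * (s - T / 2)))\<^sup>2) = 1 + (tan (w * (s - T / 2)))\<^sup>2"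
    using tan_sec[OF nz] by (simp add: power_inverse)
  ultimately show ?thesis
    by (simp add: curvature_def power2_eq_square algebra_simps)
qed

text \<open>\<open>p\<close>, \<open>q\<close>, \<open>w\<close> are the spatial partial derivatives
  of \<open>calibration\<close>, and the factor of \<open>l\<close> is the Hamiltonian plus 1/2.
  With \<open>l = 1\<close> and a resting point this is the Hamilton--Jacobi equation; in general
  the clock \<open>\<sigma>\<close> runs independently of the curve.\<close>

lemma calibration_deriv:
  assumes wT: "\<bar>w\<bar> * T < pi" and s: "\<sigma> t \<in> {0..T}"
    and der: "(\<sigma> has_real_derivative l) (at t)" "(x has_real_derivative a) (at t)"
      "(y has_real_derivative b) (at t)" "(z has_real_derivative d) (at t)"
  defines "p \<equiv> U (\<sigma> t) + curvature T (\<sigma> t) * (x t - X (\<sigma> t))"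
    and "q \<equiv> V (\<sigma> t) + curvature T (\<sigma> t) * (y t - Y (\<sigma> t))"
  shows "((\<lambda>t. calibration T (\<sigma> t) (x t) (y t) (z t)) has_real_derivative
     p * a + q * b + w * d - l * ((p\<^sup>2 + q\<^sup>2 + w\<^sup>2 * ((x t)\<^sup>2 + (y t)\<^sup>2) + 1) / 2)) (at t)"
proof -
  let ?k = "curvature T (\<sigma> t)"
  let ?X = "X (\<sigma> t)" and ?Y = "Y (\<sigma> t)" and ?U = "U (\<sigma> t)" and ?V = "V (\<sigma> t)"
  note dX = DERIV_chain2[OF X' der(1)] and dY = DERIV_chain2[OF Y' der(1)]
    and dZ = DERIV_chain2[OF Z' der(1)] and dU = DERIV_chain2[OF U' der(1)]
    and dV = DERIV_chain2[OF V' der(1)] and dk = DERIV_chain2[OF curvature_deriv[OF wT s] der(1)]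
  note dx = DERIV_diff[OF der(2) dX] and dy = DERIV_diff[OF der(3) dY]
  note deriv = DERIV_add[OF DERIV_add[OF DERIV_add[OF DERIV_mult[OF dU dx] DERIV_mult[OF dV dy]]
      DERIV_mult[OF DERIV_cdivide[OF dk, of 2] DERIV_add[OF DERIV_mult[OF dx dx] DERIV_mult[OF dy dy]]]]
      DERIV_cmult[OF DERIV_diff[OF der(4) dZ], of w]]
  show ?thesis
    unfolding calibration_def p_def q_def
    by (rule DERIV_cong[OF deriv]) (rule calibration_identity[OF energy])
qed

lemma trajectory_proj [simp]: "px (trajectory t) = X t" "py (trajectory t) = Y t" "pz (trajectory t) = Z t"
  by (simp_all add: trajectory_def px_def py_def pz_def)

lemma rad_trajectory: "(rad (trajectory t))\<^sup>2 = (X t)\<^sup>2 + (Y t)\<^sup>2"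
  by (simp add: rad_square)

lemma continuous_components:
  "continuous_on S X" "continuous_on S Y" "continuous_on S Z" "continuous_on S U" "continuous_on S V"
  by (meson DERIV_continuous X' Y' Z' U' V' continuous_at_imp_continuous_on)+

text \<open>If the competitor had length \<open>L < T\<close>, the calibration would be at most 0 at
  time \<open>L\<close> in the common end point, because it starts at 0 and does not increase along
  the competitor. Yet there it is at least \<open>(T - L) / 2\<close>, because it vanishes at time
  \<open>T\<close> and decreases in time at rate at least 1/2.\<close>

lemma time_le_cc_length:
  assumes T: "0 < T" "\<bar>w\<bar> * T < pi"
    and adm: "admissible T' \<eta>" and ends: "\<eta> 0 = trajectory 0" "\<eta> T' = trajectory T"
  shows "T \<le> cc_length T' \<eta>"
proof -
  obtain a b c N where N: "negligible N"
    and dx: "\<forall>t\<in>{0<..<T'} - N. ((\<lambda>s. px (\<eta> s)) has_real_derivative a t) (at t)"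
    and dy: "\<forall>t\<in>{0<..<T'} - N. ((\<lambda>s. py (\<eta> s)) has_real_derivative b t) (at t)"
    and dz: "\<forall>t\<in>{0<..<T'} - N. ((\<lambda>s. pz (\<eta> s)) has_real_derivative c t * rad (\<eta> t)) (at t)"
    and dom: "dominated_increments (\<lambda>t. px (\<eta> t)) 0 T'"
      "dominated_increments (\<lambda>t. py (\<eta> t)) 0 T'" "dominated_increments (\<lambda>t. pz (\<eta> t)) 0 T'"
    and c0: "\<forall>t. rad (\<eta> t) = 0 \<longrightarrow> c t = 0"
    and absl: "(\<lambda>t. sqrt ((a t)\<^sup>2 + (b t)\<^sup>2 + (c t)\<^sup>2)) absolutely_integrable_on {0..T'}"
    by (rule admissible_rates[OF adm])
  define l where "l t = sqrt ((a t)\<^sup>2 + (b t)\<^sup>2 + (c t)\<^sup>2)" for t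
  define \<sigma> where "\<sigma> t = integral {0..t} l" for t
  have T'0: "0 \<le> T'" using adm by (simp add: admissible_def)
  have absl: "l absolutely_integrable_on {0..T'}" using absl unfolding l_def[abs_def] .
  then have intl: "l integrable_on {0..T'}" by (simp add: absolutely_integrable_on_def)
  have length: "cc_length T' \<eta> = \<sigma> T'"
  proof (cases "T' = 0")
    case True then show ?thesis by (simp add: cc_length_def \<sigma>_def)
  next
    case False
    show ?thesis
      unfolding \<sigma>_def l_def[abs_def]
    proof (rule cc_length_eq[where N = "N \<union> {0, T'}"])
      show "0 < T'" using False T'0 by simp
      show "negligible (N \<union> {0, T'})" using N by auto
    qed (use dx dy dz c0 in \<open>auto intro: has_field_derivative_at_within\<close>)
  qed
  have \<sigma>0: "\<sigma> 0 = 0" by (simp add: \<sigma>_def)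
  have \<sigma>_mono: "\<sigma> u \<le> \<sigma> v" if "0 \<le> u" "u \<le> v" "v \<le> T'" for u v
    unfolding \<sigma>_def
    by (rule integral_subset_le)
       (use that integrable_subinterval_real[OF intl] in \<open>auto simp: l_def\<close>)
  have dom\<sigma>: "dominated_increments \<sigma> 0 T'"
    by (rule dominated_increments_indefinite_integral[OF absl]) (simp add: \<sigma>_def)
  obtain M where M: "negligible M"
    and d\<sigma>: "\<And>t. \<lbrakk>0 < t; t < T'; t \<notin> M\<rbrakk> \<Longrightarrow> (\<sigma> has_real_derivative l t) (at t)"
    using antiderivative_ae[OF intl, of \<sigma>] by (auto simp: \<sigma>_def)
  show ?thesis
  proof (rule ccontr)
    assume "\<not> T \<le> cc_length T' \<eta>"
    then have L: "\<sigma> T' < T" by (simp add: length)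
    \<comment> \<open>The assumption to be refuted keeps the clock inside the interval on which the
      curvature has no pole.\<close>
    have range: "\<sigma> t \<in> {0..T}" if "t \<in> {0..T'}" for t
      using \<sigma>_mono[of 0 t] \<sigma>_mono[of t T'] \<sigma>0 L that by auto
    define G where "G t = calibration T (\<sigma> t) (px (\<eta> t)) (py (\<eta> t)) (pz (\<eta> t))" for t
    have comp: "dominated_increments (\<lambda>t. F (\<sigma> t)) 0 T'"
      if "\<And>s. s \<in> {0..T} \<Longrightarrow> (F has_real_derivative F' s) (at s)" "continuous_on {0..T} F'" for F F'
      by (rule dominated_increments_compose[OF dom\<sigma> range that])
    have cont_curv: "continuous_on {0..T} (curvature T)"
      using curvature_deriv[OF T(2)] by (meson DERIV_continuous continuous_at_imp_continuous_on)
    have "dominated_increments G 0 T'"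
      unfolding G_def[abs_def] calibration_def
      by (intro dominated_increments_add dominated_increments_mult dominated_increments_diff
          dominated_increments_const dom comp[OF U'] comp[OF V'] comp[OF X'] comp[OF Y'] comp[OF Z']
          comp[OF DERIV_cdivide[OF curvature_deriv[OF T(2)]]]
          continuous_intros continuous_components cont_curv) auto
    then have "G T' \<le> G 0"
    proof (rule dominated_increments_nonincreasing[OF _ T'0])
      show "negligible (N \<union> M)" using N M by auto
      fix t assume t: "0 < t" "t < T'" "t \<notin> N \<union> M"
      define p where "p = U (\<sigma> t) + curvature T (\<sigma> t) * (px (\<eta> t) - X (\<sigma> t))"
      define q where "q = V (\<sigma> t) + curvature T (\<sigma> t) * (py (\<eta> t) - Y (\<sigma> t))"
      have "(G has_real_derivative p * a t + q * b t + w * (c t * rad (\<eta> t))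
          - l t * ((p\<^sup>2 + q\<^sup>2 + w\<^sup>2 * ((px (\<eta> t))\<^sup>2 + (py (\<eta> t))\<^sup>2) + 1) / 2)) (at t)"
        unfolding G_def[abs_def] p_def q_def
        by (rule calibration_deriv[OF T(2)]) (use t range dx dy dz d\<sigma> in auto)
      \<comment> \<open>In the orthonormal frame the vertical momentum is \<open>w * rad\<close> and
        the vertical velocity is \<open>c\<close>, since \<open>z\<close> has derivative
        \<open>c * rad\<close>.\<close>
      moreover have "p * a t + q * b t + w * (c t * rad (\<eta> t))
          - l t * ((p\<^sup>2 + q\<^sup>2 + w\<^sup>2 * ((px (\<eta> t))\<^sup>2 + (py (\<eta> t))\<^sup>2) + 1) / 2) \<le> 0"
        using linear_form_le_length[of p "a t" q "b t" "w * rad (\<eta> t)" "c t"]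
        by (simp add: l_def power_mult_distrib rad_square algebra_simps)
      ultimately show "\<exists>D\<le>0. (G has_real_derivative D) (at t)" by blast
    qed
    moreover have "G 0 = 0" by (simp add: G_def calibration_def \<sigma>0 ends)
    \<comment> \<open>At a fixed point the time derivative of the calibration is minus (Hamiltonian
      + 1/2). Adding \<open>s / 2\<close> leaves minus the Hamiltonian, which is
      nonpositive.\<close>
    moreover have "H T \<le> H (\<sigma> T')" if H: "H = (\<lambda>s. calibration T s (X T) (Y T) (Z T) + s / 2)" for H
    proof (rule DERIV_nonpos_imp_nonincreasing[where a="\<sigma> T'" and b=T and f=H])
      show "\<sigma> T' \<le> T" using L by simp
      fix s assume s: "\<sigma> T' \<le> s" "s \<le> T"
      then have "s \<in> {0..T}" using range[of T'] T'0 by auto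
      then have "((\<lambda>s. calibration T s (X T) (Y T) (Z T)) has_real_derivative
        (U s + curvature T s * (X T - X s)) * 0 + (V s + curvature T s * (Y T - Y s)) * 0 + w * 0
        - 1 * (((U s + curvature T s * (X T - X s))\<^sup>2 + (V s + curvature T s * (Y T - Y s))\<^sup>2
            + w\<^sup>2 * ((X T)\<^sup>2 + (Y T)\<^sup>2) + 1) / 2)) (at s)"
        by (intro calibration_deriv[OF T(2)] DERIV_ident DERIV_const)
      from DERIV_add[OF this DERIV_cdivide[OF DERIV_ident, of 2]]
      show "\<exists>D. (H has_real_derivative D) (at s) \<and> D \<le> 0"
        unfolding H by (intro exI conjI) (assumption, simp add: add_nonneg_nonneg)
    qed
    from this[OF refl] have "T / 2 \<le> calibration T (\<sigma> T') (X T) (Y T) (Z T) + \<sigma> T' / 2"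
      by (simp add: calibration_def[of T T])
    ultimately show False using L by (simp add: G_def ends)
  qed
qed

section \<open>Admissibility and length of the geodesics themselves\<close>

lemma Z'_rad: "(Z has_real_derivative w * rad (trajectory t) * rad (trajectory t)) (at t)"
  using Z' rad_trajectory by (simp add: power2_eq_square mult.assoc)

lemma continuous_rad: "continuous_on S (\<lambda>t. rad (trajectory t))"
  unfolding rad_def trajectory_proj by (intro continuous_intros continuous_components)

lemma trajectory_admissible:
  assumes "0 \<le> T"
  shows "admissible T trajectory"
  using assms
  by (rule smooth_admissible[where a = U and b = V and c = "\<lambda>t. w * rad (trajectory t)"])
     (auto intro!: has_field_derivative_at_within X' Y' Z'_rad continuous_intros continuous_components continuous_rad)

lemma trajectory_cc_length:
  assumes "0 < T"
  shows "cc_length T trajectory = T"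
proof -
  have "cc_length T trajectory = integral {0..T} (\<lambda>t. sqrt ((U t)\<^sup>2 + (V t)\<^sup>2 + (w * rad (trajectory t))\<^sup>2))"
    by (rule cc_length_eq[OF assms, where N = "{}"])
       (auto intro: has_field_derivative_at_within X' Y' Z'_rad)
  also have "\<dots> = T"
    using assms energy by (simp add: power_mult_distrib rad_trajectory)
  finally show ?thesis .
qed

lemma trajectory_minimizer:
  assumes "0 < T" "\<bar>w\<bar> * T < pi"
  shows "length_minimizer T trajectory"
  using assms time_le_cc_length trajectory_admissible trajectory_cc_length
  by (auto simp: length_minimizer_def)

end

section \<open>Loss of optimality\<close>

lemma has_integral_antiderivative:
  assumes "a \<le> b" "\<And>t. (F has_real_derivative f t) (at t)"
  shows "(f has_integral F b - F a) {a..b}"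
  using assms
  by (intro fundamental_theorem_of_calculus)
     (auto simp: has_real_derivative_iff_has_vector_derivative[symmetric] intro: has_field_derivative_at_within)

lemma integral_pos:
  fixes f :: "real \<Rightarrow> real"
  assumes "continuous_on {a..b} f" "a < b" "\<And>t. 0 \<le> f t" "t \<in> {a..b}" "f t \<noteq> 0"
  shows "0 < integral {a..b} f"
proof -
  have "0 \<le> integral {a..b} f"
    using assms by (intro Henstock_Kurzweil_Integration.integral_nonneg integrable_continuous_interval) auto
  moreover have "integral {a..b} f \<noteq> 0"
    using integral_eq_0_iff[OF assms(1,2)] assms by blast
  ultimately show ?thesis by simp
qed

context unit_geodesic
begin

text \<open>Past the critical time the competitor adds to the planar part of the geodesic a multiple of
  \<open>sin (\<pi> t / T)\<close> in a fixed direction \<open>e\<close>, and moves vertically with \<open>z' = \<kappa> r\<^sup>2\<close>.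
  Choosing \<open>e\<close> orthogonal to \<open>\<integral> sin (\<pi> t / T) (X, Y)\<close> makes \<open>\<integral> r\<^sup>2\<close> change at second
  order only, so that the change of \<open>\<kappa>\<close> does not affect the sign of the second variation.\<close>

lemma trajectory_not_minimizer:
  assumes off_axis: "X 0 \<noteq> 0 \<or> Y 0 \<noteq> 0" and T: "0 < T" "pi < \<bar>w\<bar> * T"
  shows "\<not> length_minimizer T trajectory"
proof -
  \<comment> \<open>The lowest frequency whose sine vanishes at both ends of \<open>[0, T]\<close>;
    past the critical time it lies below \<open>|w|\<close>.\<close>
  define k where "k = pi / T"
  have k: "0 < k" "k < \<bar>w\<bar>" "k * T = pi" using T by (auto simp: k_def field_simps)
  have kw: "k\<^sup>2 < w\<^sup>2" using power_strict_mono[of k "\<bar>w\<bar>" 2] k by simp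
  let ?\<phi> = "\<lambda>t. sin (k * t)"
  define A where "A = integral {0..T} (\<lambda>t. ?\<phi> t * X t)"
  define B where "B = integral {0..T} (\<lambda>t. ?\<phi> t * Y t)"
  define P where "P = integral {0..T} (\<lambda>t. (?\<phi> t)\<^sup>2)"
  define K where "K = integral {0..T} (\<lambda>t. (X t)\<^sup>2 + (Y t)\<^sup>2)"
  note cont = continuous_intros continuous_components
  have iA: "((\<lambda>t. ?\<phi> t * X t) has_integral A) {0..T}" and iB: "((\<lambda>t. ?\<phi> t * Y t) has_integral B) {0..T}"
    and iP: "((\<lambda>t. (?\<phi> t)\<^sup>2) has_integral P) {0..T}"
    and iK: "((\<lambda>t. (X t)\<^sup>2 + (Y t)\<^sup>2) has_integral K) {0..T}"
    unfolding A_def B_def P_def K_def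
    by (intro integrable_integral integrable_continuous_interval cont)+
  have P: "0 < P"
    unfolding P_def
  proof (rule integral_pos)
    show "T / 2 \<in> {0..T}" "(sin (k * (T / 2)))\<^sup>2 \<noteq> 0" using T k(3) by auto
  qed (use T in \<open>auto intro!: cont\<close>)
  \<comment> \<open>The starting point off the axis makes the integrand positive at time 0.\<close>
  have K: "0 < K"
    unfolding K_def
  proof (rule integral_pos)
    show "0 \<in> {0..T}" "(X 0)\<^sup>2 + (Y 0)\<^sup>2 \<noteq> 0" using T off_axis by (auto simp: sum_power2_eq_zero_iff)
  qed (use T in \<open>auto intro!: cont\<close>)
  \<comment> \<open>Integration by parts, here and in the next two integrals: the boundary terms
    vanish with the sine, and every integral containing its derivative reduces to \<open>P\<close>,
    \<open>A\<close> or \<open>B\<close>.\<close>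
  have "((\<lambda>t. (k * cos (k * t))\<^sup>2 - k\<^sup>2 * (?\<phi> t)\<^sup>2) has_integral
      k * cos (k * T) * ?\<phi> T - k * cos (k * 0) * ?\<phi> 0) {0..T}"
    by (rule has_integral_antiderivative)
       (use T in \<open>auto intro!: derivative_eq_intros simp: power2_eq_square algebra_simps\<close>)
  from has_integral_add[OF this has_integral_mult_right[OF iP, of "k\<^sup>2"]]
  have iP': "((\<lambda>t. (k * cos (k * t))\<^sup>2) has_integral k\<^sup>2 * P) {0..T}" by (simp add: k(3))
  have "((\<lambda>t. k * cos (k * t) * U t - w\<^sup>2 * (?\<phi> t * X t)) has_integral ?\<phi> T * U T - ?\<phi> 0 * U 0) {0..T}"
    by (rule has_integral_antiderivative)
       (use T in \<open>auto intro!: derivative_eq_intros U' simp: algebra_simps\<close>)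
  from has_integral_add[OF this has_integral_mult_right[OF iA, of "w\<^sup>2"]]
  have iA': "((\<lambda>t. k * cos (k * t) * U t) has_integral w\<^sup>2 * A) {0..T}" by (simp add: k(3))
  have "((\<lambda>t. k * cos (k * t) * V t - w\<^sup>2 * (?\<phi> t * Y t)) has_integral ?\<phi> T * V T - ?\<phi> 0 * V 0) {0..T}"
    by (rule has_integral_antiderivative)
       (use T in \<open>auto intro!: derivative_eq_intros V' simp: algebra_simps\<close>)
  from has_integral_add[OF this has_integral_mult_right[OF iB, of "w\<^sup>2"]]
  have iB': "((\<lambda>t. k * cos (k * t) * V t) has_integral w\<^sup>2 * B) {0..T}" by (simp add: k(3))
  have "((\<lambda>t. 1 - w\<^sup>2 * ((X t)\<^sup>2 + (Y t)\<^sup>2)) has_integral T - w\<^sup>2 * K) {0..T}"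
    using has_integral_diff[OF has_integral_const_real[of 1 0 T] has_integral_mult_right[OF iK, of "w\<^sup>2"]] T
    by simp
  then have iE: "((\<lambda>t. (U t)\<^sup>2 + (V t)\<^sup>2) has_integral T - w\<^sup>2 * K) {0..T}"
    by (rule has_integral_eq[rotated]) (use energy in \<open>simp add: algebra_simps\<close>)
  have dZ: "Z T - Z 0 = w * K"
    using has_integral_unique[OF has_integral_antiderivative[OF _ Z'] has_integral_mult_right[OF iK, of w]] T
    by simp
  \<comment> \<open>\<open>\<delta>\<close> is the prescribed increase of the integral of
    \<open>r^2\<close>. It will cost \<open>k^2 \<delta>\<close> of planar energy and save
    \<open>w^2 K \<delta> / (K + \<delta>)\<close> of vertical energy. The saving wins if
    \<open>\<delta> < K (w^2 - k^2) / k^2\<close>; half of this bound is taken.\<close>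
  define \<delta> where "\<delta> = K * (w\<^sup>2 - k\<^sup>2) / (2 * k\<^sup>2)"
  have \<delta>: "0 < \<delta>" using K kw k by (simp add: \<delta>_def)
  obtain e1 e2 where e: "e1 * A + e2 * B = 0" "0 < e1\<^sup>2 + e2\<^sup>2"
  proof (cases "A = 0 \<and> B = 0")
    case True then show ?thesis using that[of 1 0] by simp
  next
    case False
    then have "0 < (- B)\<^sup>2 + A\<^sup>2" by (auto simp: sum_power2_gt_zero_iff)
    then show ?thesis using that[of "- B" A] by simp
  qed
  define \<epsilon> where "\<epsilon> = sqrt (\<delta> / (P * (e1\<^sup>2 + e2\<^sup>2)))"
  define f1 where "f1 = \<epsilon> * e1"
  define f2 where "f2 = \<epsilon> * e2"
  have f: "f1 * A + f2 * B = 0" "(f1\<^sup>2 + f2\<^sup>2) * P = \<delta>"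
  proof -
    have "f1 * A + f2 * B = \<epsilon> * (e1 * A + e2 * B)" by (simp add: f1_def f2_def algebra_simps)
    then show "f1 * A + f2 * B = 0" using e by simp
    have "(f1\<^sup>2 + f2\<^sup>2) * P = \<epsilon>\<^sup>2 * (P * (e1\<^sup>2 + e2\<^sup>2))"
      by (simp add: f1_def f2_def power_mult_distrib algebra_simps)
    also have "\<epsilon>\<^sup>2 = \<delta> / (P * (e1\<^sup>2 + e2\<^sup>2))" using \<delta> P e by (simp add: \<epsilon>_def)
    finally show "(f1\<^sup>2 + f2\<^sup>2) * P = \<delta>" using P e(2) by (auto split: if_splits)
  qed
  define x where "x t = X t + f1 * ?\<phi> t" for t
  define y where "y t = Y t + f2 * ?\<phi> t" for t
  define u where "u t = U t + f1 * (k * cos (k * t))" for t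
  define v where "v t = V t + f2 * (k * cos (k * t))" for t
  \<comment> \<open>The rate at which the enlarged integral \<open>K + \<delta>\<close> still
    produces the height difference \<open>w * K\<close> of the geodesic.\<close>
  define \<kappa> where "\<kappa> = w * K / (K + \<delta>)"
  define z where "z t = Z 0 + \<kappa> * integral {0..t} (\<lambda>s. (x s)\<^sup>2 + (y s)\<^sup>2)" for t
  define \<eta> where "\<eta> t = (x t, y t, z t)" for t
  have \<eta>: "px (\<eta> t) = x t" "py (\<eta> t) = y t" "pz (\<eta> t) = z t" for t
    by (simp_all add: \<eta>_def px_def py_def pz_def)
  have contxy: "continuous_on S x" "continuous_on S y" "continuous_on S u" "continuous_on S v" for S
    unfolding x_def[abs_def] y_def[abs_def] u_def[abs_def] v_def[abs_def] by (intro cont)+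
  have dx: "(x has_real_derivative u t) (at t)" and dy: "(y has_real_derivative v t) (at t)" for t
    unfolding x_def[abs_def] y_def[abs_def] u_def v_def by (auto intro!: derivative_eq_intros X' Y')
  have dz: "(z has_real_derivative (\<kappa> * rad (\<eta> t)) * rad (\<eta> t)) (at t within {0..T})" if "t \<in> {0..T}" for t
  proof -
    have "((\<lambda>t. integral {0..t} (\<lambda>s. (x s)\<^sup>2 + (y s)\<^sup>2)) has_real_derivative (x t)\<^sup>2 + (y t)\<^sup>2) (at t within {0..T})"
      by (rule integral_has_real_derivative) (use that in \<open>auto intro!: continuous_intros contxy\<close>)
    moreover have "(\<kappa> * rad (\<eta> t)) * rad (\<eta> t) = \<kappa> * ((x t)\<^sup>2 + (y t)\<^sup>2)"
      using rad_square[of "\<eta> t"] by (simp add: \<eta> power2_eq_square)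
    ultimately show ?thesis
      unfolding z_def[abs_def] by (auto intro!: derivative_eq_intros)
  qed
  have contrad: "continuous_on S (\<lambda>t. rad (\<eta> t))" for S
    unfolding rad_def \<eta> by (intro continuous_intros contxy)
  have adm: "admissible T \<eta>"
    by (rule smooth_admissible[where a = u and b = v and c = "\<lambda>t. \<kappa> * rad (\<eta> t)"])
       (use T dz in \<open>auto simp: \<eta> intro!: has_field_derivative_at_within dx dy continuous_intros contxy contrad\<close>)
  have "((\<lambda>t. (X t)\<^sup>2 + (Y t)\<^sup>2 + 2 * (f1 * (?\<phi> t * X t) + f2 * (?\<phi> t * Y t)) + (f1\<^sup>2 + f2\<^sup>2) * (?\<phi> t)\<^sup>2)
      has_integral K + 2 * (f1 * A + f2 * B) + (f1\<^sup>2 + f2\<^sup>2) * P) {0..T}"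
    by (intro has_integral_add has_integral_mult_right iA iB iK iP)
  then have iR: "((\<lambda>t. (x t)\<^sup>2 + (y t)\<^sup>2) has_integral K + \<delta>) {0..T}"
    unfolding f by (simp add: x_def y_def power2_eq_square algebra_simps)
  have ends: "\<eta> 0 = trajectory 0" "\<eta> T = trajectory T"
    using dZ K \<delta> integral_unique[OF iR]
    by (auto simp: \<eta>_def trajectory_def x_def y_def z_def \<kappa>_def k(3))
  let ?q = "\<lambda>t. (u t)\<^sup>2 + (v t)\<^sup>2 + (\<kappa> * rad (\<eta> t))\<^sup>2"
  have "((\<lambda>t. (U t)\<^sup>2 + (V t)\<^sup>2 + 2 * (f1 * (k * cos (k * t) * U t) + f2 * (k * cos (k * t) * V t))
        + (f1\<^sup>2 + f2\<^sup>2) * (k * cos (k * t))\<^sup>2 + \<kappa>\<^sup>2 * ((x t)\<^sup>2 + (y t)\<^sup>2))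
      has_integral T - w\<^sup>2 * K + 2 * (f1 * (w\<^sup>2 * A) + f2 * (w\<^sup>2 * B)) + (f1\<^sup>2 + f2\<^sup>2) * (k\<^sup>2 * P) + \<kappa>\<^sup>2 * (K + \<delta>)) {0..T}"
    by (intro has_integral_add has_integral_mult_right iA' iB' iE iP' iR)
  moreover have "T - w\<^sup>2 * K + 2 * (f1 * (w\<^sup>2 * A) + f2 * (w\<^sup>2 * B)) + (f1\<^sup>2 + f2\<^sup>2) * (k\<^sup>2 * P) + \<kappa>\<^sup>2 * (K + \<delta>)
      = T - w\<^sup>2 * K + k\<^sup>2 * \<delta> + \<kappa>\<^sup>2 * (K + \<delta>)"
  proof -
    have "f1 * (w\<^sup>2 * A) + f2 * (w\<^sup>2 * B) = w\<^sup>2 * (f1 * A + f2 * B)" by (simp add: algebra_simps)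
    moreover have "(f1\<^sup>2 + f2\<^sup>2) * (k\<^sup>2 * P) = k\<^sup>2 * \<delta>" by (simp flip: f(2))
    ultimately show ?thesis using f(1) by simp
  qed
  ultimately have iq: "(?q has_integral T - w\<^sup>2 * K + k\<^sup>2 * \<delta> + \<kappa>\<^sup>2 * (K + \<delta>)) {0..T}"
    by (simp add: u_def v_def power_mult_distrib rad_square \<eta>) (simp add: power2_eq_square algebra_simps)
  have "cc_length T \<eta> = integral {0..T} (\<lambda>t. sqrt (?q t))"
    by (rule cc_length_eq[OF T(1), where N = "{}"])
       (use T dz in \<open>auto simp: \<eta> intro!: has_field_derivative_at_within dx dy\<close>)
  also have "\<dots> \<le> integral {0..T} (\<lambda>t. (1 + ?q t) / 2)"
  proof (rule integral_le)
    show "(\<lambda>t. sqrt (?q t)) integrable_on {0..T}" "(\<lambda>t. (1 + ?q t) / 2) integrable_on {0..T}"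
      by (intro integrable_continuous_interval continuous_intros contxy contrad; simp)+
    show "sqrt (?q t) \<le> (1 + ?q t) / 2" for t
      using arith_geo_mean_sqrt[of 1 "?q t"] by simp
  qed
  also have "\<dots> = (T + (T - w\<^sup>2 * K + k\<^sup>2 * \<delta> + \<kappa>\<^sup>2 * (K + \<delta>))) / 2"
    by (rule integral_unique)
       (use has_integral_divide[OF has_integral_add[OF has_integral_const_real[of 1 0 T] iq], of 2] T in simp)
  also have "\<dots> < T"
  proof -
    have "\<kappa>\<^sup>2 * (K + \<delta>) - w\<^sup>2 * K = - (w\<^sup>2 * K * \<delta> / (K + \<delta>))"
    proof -
      have "\<kappa> * (K + \<delta>) = w * K" using K \<delta> by (simp add: \<kappa>_def)
      then have "\<kappa>\<^sup>2 * (K + \<delta>) = w * K * \<kappa>" by (simp add: power2_eq_square)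
      moreover have "\<kappa> = w - w * \<delta> / (K + \<delta>)" using K \<delta> by (simp add: \<kappa>_def field_simps)
      then have "w * K * \<kappa> = w * K * w - w * K * (w * \<delta> / (K + \<delta>))"
        by (metis right_diff_distrib)
      moreover have "w * K * w = w\<^sup>2 * K" "w * K * (w * \<delta> / (K + \<delta>)) = w\<^sup>2 * K * \<delta> / (K + \<delta>)"
        by (simp_all add: power2_eq_square)
      ultimately show ?thesis by linarith
    qed
    moreover have "k\<^sup>2 * (K + \<delta>) < w\<^sup>2 * K"
    proof -
      have "k\<^sup>2 * (K + \<delta>) = K * (k\<^sup>2 + w\<^sup>2) / 2"
        using k by (simp add: \<delta>_def field_simps)
      also have "\<dots> < w\<^sup>2 * K" using K kw by (simp add: field_simps)
      finally show ?thesis .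
    qed
    then have "k\<^sup>2 * \<delta> < w\<^sup>2 * K * \<delta> / (K + \<delta>)"
      using K \<delta> by (simp add: pos_less_divide_eq mult.commute mult.left_commute)
    ultimately show ?thesis by simp
  qed
  finally have "cc_length T \<eta> < cc_length T trajectory" using trajectory_cc_length[OF T(1)] by simp
  then show ?thesis using adm ends by (auto simp: length_minimizer_def not_le)
qed

end

section \<open>Cut time and cut locus\<close>

text \<open>Rotating the phase vector \<open>(w f, g)\<close> back through the angle
  \<open>w t\<close> gives two constants of motion, so the solution need not be written down. At
  \<open>|w| t = pi\<close> the rotation is minus the identity.\<close>

lemma oscillator_antiperiodic:
  assumes f: "\<And>t. (f has_real_derivative g t) (at t)"
    and g: "\<And>t. (g has_real_derivative - (w\<^sup>2 * f t)) (at t)" and w: "w \<noteq> 0"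
  shows "f (pi / \<bar>w\<bar>) = - f 0" "g (pi / \<bar>w\<bar>) = - g 0"
proof -
  have cs: "cos (w * (pi / \<bar>w\<bar>)) = -1" "sin (w * (pi / \<bar>w\<bar>)) = 0"
    using w by (auto simp: abs_if)
  have "\<forall>t. ((\<lambda>t. w * f t * cos (w * t) - g t * sin (w * t)) has_real_derivative 0) (at t)"
    by (auto intro!: derivative_eq_intros f g simp: power2_eq_square algebra_simps)
  from DERIV_isconst_all[OF this, of "pi / \<bar>w\<bar>" 0] have "w * f (pi / \<bar>w\<bar>) = w * (- f 0)"
    unfolding cs by simp
  then show "f (pi / \<bar>w\<bar>) = - f 0" using w mult_left_cancel by blast
  have "\<forall>t. ((\<lambda>t. g t * cos (w * t) + w * f t * sin (w * t)) has_real_derivative 0) (at t)"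
    by (auto intro!: derivative_eq_intros f g simp: power2_eq_square algebra_simps)
  from DERIV_isconst_all[OF this, of "pi / \<bar>w\<bar>" 0] show "g (pi / \<bar>w\<bar>) = - g 0"
    unfolding cs by simp
qed

context unit_geodesic
begin

lemma trajectory_antipode:
  assumes w: "w \<noteq> 0"
  shows "trajectory (pi / \<bar>w\<bar>) = (- X 0, - Y 0, Z 0 + pi / (2 * w * \<bar>w\<bar>))"
proof -
  let ?\<tau> = "pi / \<bar>w\<bar>"
  have anti: "X ?\<tau> = - X 0" "U ?\<tau> = - U 0" "Y ?\<tau> = - Y 0" "V ?\<tau> = - V 0"
    using oscillator_antiperiodic[of X U w, OF X' U' w] oscillator_antiperiodic[of Y V w, OF Y' V' w]
    by auto
  \<comment> \<open>A virial identity: unit energy turns \<open>2 w Z' = 2 w^2 r^2\<close> into 1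
    minus the derivative of \<open>X U + Y V\<close>. This product term agrees at both times, as all
    its factors change sign.\<close>
  have "\<forall>t. ((\<lambda>t. 2 * w * Z t - t + (X t * U t + Y t * V t)) has_real_derivative 0) (at t)"
  proof
    fix t
    show "((\<lambda>t. 2 * w * Z t - t + (X t * U t + Y t * V t)) has_real_derivative 0) (at t)"
      using energy[of t]
      by (auto intro!: derivative_eq_intros X' Y' Z' U' V' simp: power2_eq_square algebra_simps)
  qed
  from DERIV_isconst_all[OF this, of ?\<tau> 0] have "2 * w * (Z ?\<tau> - Z 0) = ?\<tau>"
    unfolding anti by (simp add: algebra_simps)
  then have "Z ?\<tau> = Z 0 + pi / (2 * w * \<bar>w\<bar>)" using w by (simp add: field_simps)
  then show ?thesis by (simp add: trajectory_def anti)
qed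

text \<open>For \<open>w = 0\<close> the calibration works for every \<open>T\<close>. Otherwise all
  times below \<open>pi / |w|\<close> belong to the set and none above does.\<close>

lemma t_cut_trajectory:
  assumes off_axis: "X 0 \<noteq> 0 \<or> Y 0 \<noteq> 0"
  shows "t_cut trajectory = (if w = 0 then \<infinity> else ereal (pi / \<bar>w\<bar>))" (is "_ = ?c")
  unfolding t_cut_def
proof (rule Sup_eqI)
  fix y assume "y \<in> {ereal t |t. 0 < t \<and> length_minimizer t trajectory}"
  then obtain t where t: "y = ereal t" "0 < t" "length_minimizer t trajectory" by blast
  then have "\<bar>w\<bar> * t \<le> pi" using trajectory_not_minimizer[OF off_axis, of t] not_less by blast
  then show "y \<le> ?c" using t by (simp add: field_simps)
next
  fix y assume y: "\<And>z. z \<in> {ereal t |t. 0 < t \<and> length_minimizer t trajectory} \<Longrightarrow> z \<le> y"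
  have min: "ereal r \<le> y" if "0 < r" "ereal r < ?c" for r
  proof (rule y)
    have "\<bar>w\<bar> * r < pi" using that by (auto simp: field_simps split: if_splits)
    then show "ereal r \<in> {ereal t |t. 0 < t \<and> length_minimizer t trajectory}"
      using trajectory_minimizer that by blast
  qed
  have c: "0 < ?c" by simp
  show "?c \<le> y"
  proof (rule dense_le)
    fix x assume x: "x < ?c"
    \<comment> \<open>The maximum with 0 keeps \<open>r\<close> positive, as the set in
      \<open>t_cut\<close> contains only positive times.\<close>
    obtain r where r: "max 0 x < ereal r" "ereal r < ?c"
      using ereal_dense2[of "max 0 x" ?c] x c by auto
    then have "ereal r \<le> y" by (intro min) (auto simp flip: zero_ereal_def)
    then show "x \<le> y" using r(1) by (meson less_imp_le max.strict_boundedE order_trans)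
  qed
qed

end

section \<open>Normal trajectories as unit geodesics, and their existence\<close>

lemma normal_traj_unit_geodesic:
  assumes l: "(u0, v0, w0) \<in> E1 q" and traj: "normal_traj q (u0, v0, w0) \<gamma>"
  obtains U V where
    "unit_geodesic (\<lambda>t. px (\<gamma> t)) (\<lambda>t. py (\<gamma> t)) (\<lambda>t. pz (\<gamma> t)) U V w0"
    "unit_geodesic.trajectory (\<lambda>t. px (\<gamma> t)) (\<lambda>t. py (\<gamma> t)) (\<lambda>t. pz (\<gamma> t)) = \<gamma>"
    "\<gamma> 0 = q"
proof -
  obtain u v w where init: "\<gamma> 0 = q" "u 0 = u0" "v 0 = v0" "w 0 = w0"
    and ode: "\<forall>t. ((\<lambda>s. px (\<gamma> s)) has_real_derivative u t) (at t) \<and>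
             ((\<lambda>s. py (\<gamma> s)) has_real_derivative v t) (at t) \<and>
             ((\<lambda>s. pz (\<gamma> s)) has_real_derivative (rad (\<gamma> t))^2 * w t) (at t) \<and>
             (u has_real_derivative (- ((w t)^2 * px (\<gamma> t)))) (at t) \<and>
             (v has_real_derivative (- ((w t)^2 * py (\<gamma> t)))) (at t) \<and>
             (w has_real_derivative 0) (at t)"
    using traj unfolding normal_traj_def by (auto simp: px_def py_def pz_def)
  have w: "w t = w0" for t
    using DERIV_isconst_all[of w t 0] ode init by blast
  have "unit_geodesic (\<lambda>t. px (\<gamma> t)) (\<lambda>t. py (\<gamma> t)) (\<lambda>t. pz (\<gamma> t)) u v w0"
  proof
    fix t
    show "((\<lambda>t. px (\<gamma> t)) has_real_derivative u t) (at t)" "((\<lambda>t. py (\<gamma> t)) has_real_derivative v t) (at t)"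
      "(u has_real_derivative - (w0\<^sup>2 * px (\<gamma> t))) (at t)" "(v has_real_derivative - (w0\<^sup>2 * py (\<gamma> t))) (at t)"
      "((\<lambda>t. pz (\<gamma> t)) has_real_derivative w0 * ((px (\<gamma> t))\<^sup>2 + (py (\<gamma> t))\<^sup>2)) (at t)"
      using spec[OF ode, of t] unfolding w rad_square by (simp_all add: mult.commute)
    show "(u 0)\<^sup>2 + (v 0)\<^sup>2 + w0\<^sup>2 * ((px (\<gamma> 0))\<^sup>2 + (py (\<gamma> 0))\<^sup>2) = 1"
      using l by (simp add: E1_def init rad_square mult.commute) (simp add: px_def py_def pz_def)
  qed
  moreover from unit_geodesic.trajectory_def[OF this]
  have "unit_geodesic.trajectory (\<lambda>t. px (\<gamma> t)) (\<lambda>t. py (\<gamma> t)) (\<lambda>t. pz (\<gamma> t)) = \<gamma>"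
    by (auto simp: px_def py_def pz_def)
  ultimately show thesis using that init(1) by blast
qed

text \<open>Needed to realise every point of the claimed cut locus by an actual geodesic; a finite
  cut time forces \<open>w \<noteq> 0\<close>.\<close>

lemma normal_traj_exists:
  assumes w: "w \<noteq> 0" and l: "(u0, v0, w) \<in> E1 (x0, y0, z0)"
  obtains \<gamma> where "normal_traj (x0, y0, z0) (u0, v0, w) \<gamma>"
proof -
  define x where "x t = x0 * cos (w * t) + u0 / w * sin (w * t)" for t
  define y where "y t = y0 * cos (w * t) + v0 / w * sin (w * t)" for t
  define u where "u t = u0 * cos (w * t) - w * x0 * sin (w * t)" for t
  define v where "v t = v0 * cos (w * t) - w * y0 * sin (w * t)" for t
  \<comment> \<open>Solved from the conserved quantity \<open>2 w z - t + (x u + y v)\<close>, which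
    avoids integrating \<open>r^2\<close>.\<close>
  define z where "z t = z0 + (t - (x t * u t + y t * v t) + (x0 * u0 + y0 * v0)) / (2 * w)" for t
  define \<gamma> where "\<gamma> t = (x t, y t, z t)" for t
  have \<gamma>: "px (\<gamma> t) = x t" "py (\<gamma> t) = y t" "pz (\<gamma> t) = z t" for t
    by (simp_all add: \<gamma>_def px_def py_def pz_def)
  have dx: "(x has_real_derivative u t) (at t)" and dy: "(y has_real_derivative v t) (at t)"
    and du: "(u has_real_derivative - (w\<^sup>2 * x t)) (at t)"
    and dv: "(v has_real_derivative - (w\<^sup>2 * y t)) (at t)" for t
    using w unfolding x_def y_def u_def v_def
    by (auto intro!: derivative_eq_intros simp: power2_eq_square algebra_simps)
  have osc: "(a * c - w * b * s)\<^sup>2 + w\<^sup>2 * (b * c + a / w * s)\<^sup>2 = a\<^sup>2 + w\<^sup>2 * b\<^sup>2"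
    if "c\<^sup>2 + s\<^sup>2 = 1" for a b c s :: real
  proof -
    have "w\<^sup>2 * (b * c + a / w * s)\<^sup>2 = (w * b * c + a * s)\<^sup>2"
      using w by (simp add: field_simps flip: power_mult_distrib)
    then have "(a * c - w * b * s)\<^sup>2 + w\<^sup>2 * (b * c + a / w * s)\<^sup>2 = (a\<^sup>2 + w\<^sup>2 * b\<^sup>2) * (c\<^sup>2 + s\<^sup>2)"
      by (simp add: power2_eq_square algebra_simps)
    then show ?thesis using that by simp
  qed
  have osc_t: "(u t)\<^sup>2 + w\<^sup>2 * (x t)\<^sup>2 = u0\<^sup>2 + w\<^sup>2 * x0\<^sup>2" "(v t)\<^sup>2 + w\<^sup>2 * (y t)\<^sup>2 = v0\<^sup>2 + w\<^sup>2 * y0\<^sup>2" for t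
    unfolding x_def y_def u_def v_def by (rule osc, simp)+
  have "u0\<^sup>2 + v0\<^sup>2 + w\<^sup>2 * (x0\<^sup>2 + y0\<^sup>2) = 1"
    using l by (simp add: E1_def rad_square mult.commute) (simp add: px_def py_def pz_def)
  then have energy: "(u t)\<^sup>2 + (v t)\<^sup>2 + w\<^sup>2 * ((x t)\<^sup>2 + (y t)\<^sup>2) = 1" for t
    using osc_t[of t] unfolding distrib_left by linarith
  have dz: "(z has_real_derivative (rad (\<gamma> t))\<^sup>2 * w) (at t)" for t
  proof -
    have "(z has_real_derivative (1 - (u t * u t + - (w\<^sup>2 * x t) * x t + (v t * v t + - (w\<^sup>2 * y t) * y t))) / (2 * w)) (at t)"
      unfolding z_def[abs_def] using w by (auto intro!: derivative_eq_intros dx dy du dv simp: field_simps)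
    moreover have "1 - (u t * u t + - (w\<^sup>2 * x t) * x t + (v t * v t + - (w\<^sup>2 * y t) * y t))
        = 2 * w * ((rad (\<gamma> t))\<^sup>2 * w)"
      using energy[of t] unfolding rad_square \<gamma> by (simp add: power2_eq_square algebra_simps)
    ultimately show ?thesis using w by simp
  qed
  have "normal_traj (x0, y0, z0) (u0, v0, w) \<gamma>"
    unfolding normal_traj_def \<gamma>
  proof (intro conjI exI allI)
    show "\<gamma> 0 = (x0, y0, z0)" by (simp add: \<gamma>_def x_def y_def z_def u_def v_def)
    show "(\<lambda>_. w) 0 = pz (u0, v0, w)" "u 0 = px (u0, v0, w)" "v 0 = py (u0, v0, w)"
      by (simp_all add: u_def v_def px_def py_def pz_def)
  qed (use dx dy du dv dz in \<open>simp_all\<close>)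
  then show thesis by (rule that)
qed

theorem theorem14:
  fixes x0 y0 z0 :: real
  assumes "(x0, y0, z0) \<notin> {q. rad q = 0}"
  shows "(\<forall>u0 v0 w0 \<gamma>. (u0, v0, w0) \<in> E1 (x0, y0, z0) \<and> normal_traj (x0, y0, z0) (u0, v0, w0) \<gamma> \<longrightarrow>
            t_cut \<gamma> = (if w0 = 0 then \<infinity> else ereal (pi / \<bar>w0\<bar>)))
       \<and> Cut (x0, y0, z0) = {(- x0, - y0, z) | z. \<bar>z - z0\<bar> \<ge> pi * (rad (x0, y0, z0))^2 / 2}"
proof -
  let ?q = "(x0, y0, z0)"
  have r: "(rad ?q)\<^sup>2 = x0\<^sup>2 + y0\<^sup>2" by (simp add: rad_square px_def py_def)
  have off_axis: "x0 \<noteq> 0 \<or> y0 \<noteq> 0" using assms r by auto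
  have r_pos: "0 < x0\<^sup>2 + y0\<^sup>2" using off_axis by (simp add: sum_power2_gt_zero_iff)
  have cut: "t_cut \<gamma> = (if w0 = 0 then \<infinity> else ereal (pi / \<bar>w0\<bar>))"
    and antipode: "w0 \<noteq> 0 \<Longrightarrow> \<gamma> (pi / \<bar>w0\<bar>) = (- x0, - y0, z0 + pi / (2 * w0 * \<bar>w0\<bar>))"
    if traj: "(u0, v0, w0) \<in> E1 ?q" "normal_traj ?q (u0, v0, w0) \<gamma>" for u0 v0 w0 \<gamma>
  proof -
    obtain U V where geo: "unit_geodesic (\<lambda>t. px (\<gamma> t)) (\<lambda>t. py (\<gamma> t)) (\<lambda>t. pz (\<gamma> t)) U V w0"
      and trajectory: "unit_geodesic.trajectory (\<lambda>t. px (\<gamma> t)) (\<lambda>t. py (\<gamma> t)) (\<lambda>t. pz (\<gamma> t)) = \<gamma>"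
      and "\<gamma> 0 = ?q"
      by (rule normal_traj_unit_geodesic[OF traj])
    then have init: "px (\<gamma> 0) = x0" "py (\<gamma> 0) = y0" "pz (\<gamma> 0) = z0"
      by (simp_all add: px_def py_def pz_def)
    show "t_cut \<gamma> = (if w0 = 0 then \<infinity> else ereal (pi / \<bar>w0\<bar>))"
      using unit_geodesic.t_cut_trajectory[OF geo] off_axis unfolding trajectory init by blast
    show "\<gamma> (pi / \<bar>w0\<bar>) = (- x0, - y0, z0 + pi / (2 * w0 * \<bar>w0\<bar>))" if "w0 \<noteq> 0"
      using unit_geodesic.trajectory_antipode[OF geo that] unfolding trajectory init .
  qed
  have "Cut ?q = {(- x0, - y0, z) | z. \<bar>z - z0\<bar> \<ge> pi * (x0\<^sup>2 + y0\<^sup>2) / 2}"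
  proof (intro equalityI subsetI)
    fix p assume "p \<in> Cut ?q"
    then obtain \<gamma> u0 v0 w0 where p: "p = \<gamma> (real_of_ereal (t_cut \<gamma>))" "t_cut \<gamma> < \<infinity>"
      and traj: "(u0, v0, w0) \<in> E1 ?q" "normal_traj ?q (u0, v0, w0) \<gamma>"
      unfolding Cut_def by auto
    have w: "w0 \<noteq> 0" using p(2) cut[OF traj] by auto
    then have "p = (- x0, - y0, z0 + pi / (2 * w0 * \<bar>w0\<bar>))"
      using p(1) cut[OF traj] antipode[OF traj] by simp
    moreover have "\<bar>pi / (2 * w0 * \<bar>w0\<bar>)\<bar> \<ge> pi * (x0\<^sup>2 + y0\<^sup>2) / 2"
    proof -
      have "u0\<^sup>2 + v0\<^sup>2 + (x0\<^sup>2 + y0\<^sup>2) * w0\<^sup>2 = 1"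
        using traj(1) by (simp add: E1_def r) (simp add: px_def py_def pz_def)
      then have "(x0\<^sup>2 + y0\<^sup>2) * w0\<^sup>2 \<le> 1"
        using zero_le_power2[of u0] zero_le_power2[of v0] by linarith
      then have "x0\<^sup>2 + y0\<^sup>2 \<le> 1 / w0\<^sup>2" using w by (simp add: pos_le_divide_eq)
      then have "pi / 2 * (x0\<^sup>2 + y0\<^sup>2) \<le> pi / 2 * (1 / w0\<^sup>2)" by (intro mult_left_mono) auto
      then show ?thesis by (simp add: abs_mult power2_eq_square)
    qed
    ultimately show "p \<in> {(- x0, - y0, z) | z. \<bar>z - z0\<bar> \<ge> pi * (x0\<^sup>2 + y0\<^sup>2) / 2}"
      by simp
  next
    fix p assume "p \<in> {(- x0, - y0, z) | z. \<bar>z - z0\<bar> \<ge> pi * (x0\<^sup>2 + y0\<^sup>2) / 2}"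
    then obtain z where p: "p = (- x0, - y0, z)" and z: "\<bar>z - z0\<bar> \<ge> pi * (x0\<^sup>2 + y0\<^sup>2) / 2" by blast
    define h where "h = z - z0"
    have h2: "pi * (x0\<^sup>2 + y0\<^sup>2) \<le> 2 * \<bar>h\<bar>" using z by (simp add: h_def)
    then have h: "0 < \<bar>h\<bar>" using mult_pos_pos[OF pi_gt_zero r_pos] by linarith
    \<comment> \<open>The solution of \<open>pi / (2 w |w|) = h\<close>: the sign of
      \<open>w\<close> is that of \<open>h\<close>, and \<open>w^2 = pi / (2 |h|)\<close>.\<close>
    define w where "w = sgn h * sqrt (pi / (2 * \<bar>h\<bar>))"
    have absw: "\<bar>w\<bar> = sqrt (pi / (2 * \<bar>h\<bar>))" using h by (auto simp: w_def abs_mult sgn_if)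
    have w: "w \<noteq> 0" using h by (auto simp: w_def sgn_zero_iff)
    have w2: "w\<^sup>2 = pi / (2 * \<bar>h\<bar>)"
      using absw by (metis power2_abs real_sqrt_pow2 divide_nonneg_nonneg pi_ge_zero abs_ge_zero mult_nonneg_nonneg zero_le_numeral)
    have "(x0\<^sup>2 + y0\<^sup>2) * w\<^sup>2 \<le> 1" using h h2 by (simp add: w2 mult.commute)
    \<comment> \<open>The bound on \<open>|h|\<close> is exactly what makes the radicand
      nonnegative. The remaining energy goes into \<open>u0\<close>; its planar direction does not
      affect the end point.\<close>
    then have l: "(sqrt (1 - (x0\<^sup>2 + y0\<^sup>2) * w\<^sup>2), 0, w) \<in> E1 ?q"
      by (simp add: E1_def r) (simp add: px_def py_def pz_def)
    obtain \<gamma> where traj: "normal_traj ?q (sqrt (1 - (x0\<^sup>2 + y0\<^sup>2) * w\<^sup>2), 0, w) \<gamma>"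
      using normal_traj_exists[OF w l] .
    have "w * \<bar>w\<bar> = sgn h * w\<^sup>2"
      unfolding w2 using absw h by (simp add: w_def sgn_if)
    then have "pi / (2 * w * \<bar>w\<bar>) = h"
      using h by (simp add: w2 mult.assoc) (auto simp: sgn_if)
    then have "\<gamma> (real_of_ereal (t_cut \<gamma>)) = p"
      using cut[OF l traj] antipode[OF l traj] w by (simp add: p h_def)
    moreover have "t_cut \<gamma> < \<infinity>" using cut[OF l traj] w by simp
    ultimately show "p \<in> Cut ?q" unfolding Cut_def using l traj by blast
  qed
  then show ?thesis using cut unfolding r by blast
qed

end
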